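(* Let $w\in L^1(\mathbb{T}^\omega)$ with $w\ge 0$ and $\log w\in L^1(\mathbb{T}^\omega)$. Then there exists an outer function $g\in H^2_+(\mathbb{T}^\omega)$ with $w=|g|^2$ (almost everywhere) if and only if the Fourier transform $\widehat{\log w}$ is supported on $\mathbb{Z}^\infty_+\cup(-\mathbb{Z}^\infty_+)$, i.e. $\widehat{\log w}(\mathbf{n})=0$ for every $\mathbf{n}\in\mathbb{Z}^\infty\setminus\big(\mathbb{Z}^\infty_+\cup(-\mathbb{Z}^\infty_+)\big)$.
   Context: $\mathbb{T}^\omega$ is the product of countably many copies of the unit circle $\mathbb{T}$, a compact abelian group with normalized Haar measure $m_{\mathbb{T}^\omega}$; $L^p(\mathbb{T}^\omega)=L^p(m_{\mathbb{T}^\omega})$. Its dual is $\mathbb{Z}^\infty$, the group of finitely supported integer sequences $\mathbf{n}=(n_1,n_2,\dots)$, where $\mathbf{n}$ corresponds to the character $\gamma_{\mathbf{n}}(\boldsymbol{\lambda})=\prod_k\lambda_k^{n_k}$; for $f\in L^1(\mathbb{T}^\omega)$, $\hat f(\mathbf{n})=\int f\,\overline{\gamma_{\mathbf{n}}}\,dm_{\mathbb{T}^\omega}$. $\mathbb{Z}^\infty_+$ is the set of $\mathbf{n}\in\mathbb{Z}^\infty$ with all $n_k\ge 0$. $H^2_+(\mathbb{T}^\omega)=\{f\in L^2(\mathbb{T}^\omega): \hat f(\mathbf{n})=0 \text{ for all } \mathbf{n}\notin\mathbb{Z}^\infty_+\}$. A function $f\in H^2_+(\mathbb{T}^\omega)$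 is called outer if $\exp\left(\int_{\mathbb{T}^\omega}\log|f|\,dm_{\mathbb{T}^\omega}\right)=\left|\int_{\mathbb{T}^\omega}f\,dm_{\mathbb{T}^\omega}\right|$. *)

theory Defs
  imports "HOL-Probability.Probability" "HOL-Library.Poly_Mapping"
begin

definition circle_haar :: "complex measure" where
  "circle_haar = distr (restrict_space lborel {0..<1}) (restrict_space borel (sphere 0 1))
     (\<lambda>t. cis (2 * pi * t))"

text \<open>
  The product of countably many copies of the circle, as a probability space: its points are the
  sequences of complex numbers of modulus 1. The product \<open>\<sigma>\<close>-algebra is the Borel
  \<open>\<sigma>\<close>-algebra of the (second countable) product topology, so that, by
  \<open>prob_space_torus_haar\<close> and \<open>torus_haar_invariant\<close> below, this is the normalized Haar measure.
\<close>

definition torus_haar :: "(nat \<Rightarrow> complex) measure" where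
  "torus_haar = Pi\<^sub>M UNIV (\<lambda>_. circle_haar)"

lemma space_circle_haar: "space circle_haar = sphere 0 1"
  by (simp add: circle_haar_def space_restrict_space)

lemma sets_circle_haar: "sets circle_haar = sets (restrict_space borel (sphere 0 1))"
  by (simp add: circle_haar_def)

lemma measurable_cis_circle:
  "(\<lambda>t. cis (2 * pi * t)) \<in> borel \<rightarrow>\<^sub>M restrict_space borel (sphere 0 1)"
  by (intro measurable_restrict_space2 borel_measurable_continuous_onI continuous_intros) auto

lemma measurable_cis_circle':
  "(\<lambda>t. cis (2 * pi * t)) \<in> restrict_space lborel {0..<1} \<rightarrow>\<^sub>M restrict_space borel (sphere 0 1)"
  using measurable_cis_circle by (intro measurable_restrict_space1) simp

lemma prob_space_circle_haar: "prob_space circle_haar"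
  unfolding circle_haar_def
proof (rule prob_space.prob_space_distr[OF _ measurable_cis_circle'])
  show "prob_space (restrict_space lborel {0..<1::real})"
    by (rule prob_spaceI) (simp add: emeasure_restrict_space space_restrict_space)
qed

lemma measurable_rotation:
  assumes "cmod a = 1"
  shows "(\<lambda>z. a * z) \<in> circle_haar \<rightarrow>\<^sub>M circle_haar"
proof -
  have "(\<lambda>z. a * z) \<in> restrict_space borel (sphere 0 1) \<rightarrow>\<^sub>M restrict_space borel (sphere 0 1)"
    using assms
    by (intro measurable_restrict_space3 borel_measurable_continuous_onI continuous_intros)
       (auto simp: norm_mult)
  then show ?thesis
    by (simp add: circle_haar_def)
qed

lemma emeasure_circle_haar:
  assumes "A \<in> sets circle_haar"
  shows "emeasure circle_haar A =
    (\<integral>\<^sup>+ t. indicator {0..<1} t * indicator A (cis (2 * pi * t)) \<partial>lborel)"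
proof -
  have A: "A \<in> sets (restrict_space borel (sphere 0 1))"
    using assms by (simp add: sets_circle_haar)
  have "emeasure circle_haar A = (\<integral>\<^sup>+ z. indicator A z \<partial>circle_haar)"
    using assms by simp
  also have "\<dots> = (\<integral>\<^sup>+ t. indicator A (cis (2 * pi * t)) \<partial>restrict_space lborel {0..<1})"
    unfolding circle_haar_def using A
    by (subst nn_integral_distr[OF measurable_cis_circle']) simp_all
  also have "\<dots> = (\<integral>\<^sup>+ t. indicator {0..<1} t * indicator A (cis (2 * pi * t)) \<partial>lborel)"
    by (subst nn_integral_restrict_space) (simp_all add: mult.commute)
  finally show ?thesis .
qed

lemma circle_haar_invariant:
  assumes a: "cmod a = 1"
  shows "distr circle_haar circle_haar (\<lambda>z. a * z) = circle_haar"
proof (rule measure_eqI)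
  fix A assume "A \<in> sets (distr circle_haar circle_haar ((*) a))"
  then have A: "A \<in> sets circle_haar" by simp
  define s where "s = Arg2pi a / (2 * pi)"
  have s: "0 \<le> s" "s < 1"
    using Arg2pi_ge_0[of a] Arg2pi_lt_2pi[of a] by (auto simp: s_def)
  have a_eq: "a = cis (2 * pi * s)"
    using Arg2pi_eq[of a] a by (simp add: s_def cis_conv_exp mult.commute)
  define F :: "real \<Rightarrow> ennreal" where "F t = indicator A (cis (2 * pi * t))" for t
  have F_meas[measurable]: "F \<in> borel_measurable borel"
  proof -
    have "(indicator A :: complex \<Rightarrow> ennreal) \<in> borel_measurable (restrict_space borel (sphere 0 1))"
      using A by (simp add: sets_circle_haar)
    from measurable_compose[OF measurable_cis_circle this] show ?thesis
      by (simp add: F_def[abs_def])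
  qed
  have F_per: "F (1 + t) = F t" for t
    by (simp add: F_def ring_distribs cis_mult[symmetric])
  have F_rot: "indicator A (a * cis (2 * pi * t)) = F (s + t)" for t
    by (simp add: F_def a_eq cis_mult ring_distribs)
  let ?B = "(\<lambda>z. a * z) -` A \<inter> space circle_haar"
  have B: "?B \<in> sets circle_haar"
    using measurable_rotation[OF a] A by (rule measurable_sets)
  have "emeasure (distr circle_haar circle_haar ((*) a)) A = emeasure circle_haar ?B"
    using A measurable_rotation[OF a] by (simp add: emeasure_distr)
  also have "\<dots> = (\<integral>\<^sup>+ t. indicator {0..<1} t * F (s + t) \<partial>lborel)"
    unfolding emeasure_circle_haar[OF B] F_rot[symmetric]
    by (intro nn_integral_cong) (auto simp: indicator_def space_circle_haar)
  also have "\<dots> = (\<integral>\<^sup>+ t. indicator {s..<1 + s} (s + t) * F (s + t) \<partial>lborel)"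
    by (intro nn_integral_cong) (auto simp: indicator_def)
  also have "\<dots> = (\<integral>\<^sup>+ t. indicator {s..<1 + s} t * F t \<partial>lborel)"
    by (subst (2) nn_integral_real_affine[where c = 1 and t = s]) auto
  also have "\<dots> = (\<integral>\<^sup>+ t. indicator {s..<1} t * F t + indicator {1..<1 + s} t * F t \<partial>lborel)"
    using s by (intro nn_integral_cong) (auto simp: indicator_def)
  also have "\<dots> = (\<integral>\<^sup>+ t. indicator {s..<1} t * F t \<partial>lborel) +
                  (\<integral>\<^sup>+ t. indicator {1..<1 + s} t * F t \<partial>lborel)"
    by (intro nn_integral_add) auto
  also have "(\<integral>\<^sup>+ t. indicator {1..<1 + s} t * F t \<partial>lborel) =
             (\<integral>\<^sup>+ t. indicator {1..<1 + s} (1 + t) * F (1 + t) \<partial>lborel)"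
    by (subst nn_integral_real_affine[where c = 1 and t = 1]) auto
  also have "\<dots> = (\<integral>\<^sup>+ t. indicator {0..<s} t * F t \<partial>lborel)"
    unfolding F_per by (intro nn_integral_cong) (auto simp: indicator_def)
  also have "(\<integral>\<^sup>+ t. indicator {s..<1} t * F t \<partial>lborel) + \<dots> =
             (\<integral>\<^sup>+ t. indicator {s..<1} t * F t + indicator {0..<s} t * F t \<partial>lborel)"
    by (intro nn_integral_add[symmetric]) auto
  also have "\<dots> = (\<integral>\<^sup>+ t. indicator {0..<1} t * F t \<partial>lborel)"
    using s by (intro nn_integral_cong) (auto simp: indicator_def)
  also have "\<dots> = emeasure circle_haar A"
    unfolding emeasure_circle_haar[OF A] F_def ..
  finally show "emeasure (distr circle_haar circle_haar ((*) a)) A = emeasure circle_haar A" .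
qed simp

lemma prob_space_torus_haar: "prob_space torus_haar"
  unfolding torus_haar_def by (intro prob_space_PiM prob_space_circle_haar)

theorem torus_haar_invariant:
  assumes "\<And>k. cmod (a k) = 1"
  shows "distr torus_haar torus_haar (\<lambda>x k. a k * x k) = torus_haar"
proof -
  interpret product_prob_space "\<lambda>_::nat. circle_haar" UNIV
    by (intro product_prob_spaceI prob_space_circle_haar)
  show ?thesis
    unfolding torus_haar_def
  proof (rule PiM_eq)
    have meas: "(\<lambda>x k. a k * x k) \<in> Pi\<^sub>M UNIV (\<lambda>_. circle_haar) \<rightarrow>\<^sub>M Pi\<^sub>M UNIV (\<lambda>_. circle_haar)"
    proof (rule measurable_PiM_single')
      show "(\<lambda>x. a k * x k) \<in> Pi\<^sub>M UNIV (\<lambda>_. circle_haar) \<rightarrow>\<^sub>M circle_haar" for k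
        using measurable_compose[OF measurable_component_singleton[of k UNIV "\<lambda>_. circle_haar"]
            measurable_rotation[OF assms, of k]] by simp
    qed (use assms in \<open>auto simp: space_PiM space_circle_haar norm_mult\<close>)
    fix J :: "nat set" and F
    assume J: "finite J" and F: "\<And>j. j \<in> J \<Longrightarrow> F j \<in> sets circle_haar"
    let ?G = "\<lambda>j. (\<lambda>z. a j * z) -` F j \<inter> space circle_haar"
    have G: "?G j \<in> sets circle_haar" if "j \<in> J" for j
      using measurable_rotation[OF assms] F[OF that] by (rule measurable_sets)
    have preimage: "(\<lambda>x k. a k * x k) -` prod_emb UNIV (\<lambda>_. circle_haar) J (Pi\<^sub>E J F) \<inter>
        space (Pi\<^sub>M UNIV (\<lambda>_. circle_haar)) = prod_emb UNIV (\<lambda>_. circle_haar) J (Pi\<^sub>E J ?G)"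
      using assms
      by (auto simp: prod_emb_def space_PiM space_circle_haar PiE_iff norm_mult)
    have "emeasure (distr (Pi\<^sub>M UNIV (\<lambda>_. circle_haar)) (Pi\<^sub>M UNIV (\<lambda>_. circle_haar))
        (\<lambda>x k. a k * x k)) (prod_emb UNIV (\<lambda>_. circle_haar) J (Pi\<^sub>E J F)) =
      (\<Prod>j\<in>J. emeasure circle_haar (?G j))"
      using J F G by (subst emeasure_distr[OF meas]) (auto simp: preimage emeasure_PiM_emb)
    also have "\<dots> = (\<Prod>j\<in>J. emeasure (distr circle_haar circle_haar (\<lambda>z. a j * z)) (F j))"
      using F by (intro prod.cong refl emeasure_distr[symmetric] measurable_rotation assms)
    finally show "emeasure (distr (Pi\<^sub>M UNIV (\<lambda>_. circle_haar)) (Pi\<^sub>M UNIV (\<lambda>_. circle_haar))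
        (\<lambda>x k. a k * x k)) (prod_emb UNIV (\<lambda>_. circle_haar) J (Pi\<^sub>E J F)) =
      (\<Prod>j\<in>J. emeasure circle_haar (F j))"
      by (simp add: circle_haar_invariant assms)
  qed simp
qed

definition character :: "(nat \<Rightarrow>\<^sub>0 int) \<Rightarrow> (nat \<Rightarrow> complex) \<Rightarrow> complex" where
  "character n x = (\<Prod>k\<in>Poly_Mapping.keys n. x k powi Poly_Mapping.lookup n k)"

definition fourier :: "((nat \<Rightarrow> complex) \<Rightarrow> complex) \<Rightarrow> (nat \<Rightarrow>\<^sub>0 int) \<Rightarrow> complex" where
  "fourier f n = (\<integral>x. f x * cnj (character n x) \<partial>torus_haar)"

definition Z_plus :: "(nat \<Rightarrow>\<^sub>0 int) set" where
  "Z_plus = {n. \<forall>k. 0 \<le> Poly_Mapping.lookup n k}"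

definition H2_plus :: "((nat \<Rightarrow> complex) \<Rightarrow> complex) set" where
  "H2_plus = {f. f \<in> borel_measurable torus_haar \<and> integrable torus_haar (\<lambda>x. (cmod (f x))\<^sup>2) \<and>
     (\<forall>n. n \<notin> Z_plus \<longrightarrow> fourier f n = 0)}"

text \<open>
  In HOL \<open>ln 0 = 0\<close>, whereas here the logarithm of 0 has to be \<open>-\<infinity>\<close>. Hence logarithms
  take values in the extended reals, and so do their integrals, with \<open>exp (-\<infinity>) = 0\<close>.
\<close>

definition log_ext :: "real \<Rightarrow> ereal" where
  "log_ext r = (if r > 0 then ereal (ln r) else - \<infinity>)"

definition exp_ext :: "ereal \<Rightarrow> ereal" where
  "exp_ext r = (if r = - \<infinity> then 0 else if r = \<infinity> then \<infinity> else ereal (exp (real_of_ereal r)))"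

text \<open>
  \<open>e2ennreal\<close> sends negative numbers to 0, so the two integrals are those of the positive and
  the negative part.
\<close>

definition ext_integral :: "'a measure \<Rightarrow> ('a \<Rightarrow> ereal) \<Rightarrow> ereal" where
  "ext_integral M u =
     enn2ereal (\<integral>\<^sup>+x. e2ennreal (u x) \<partial>M) - enn2ereal (\<integral>\<^sup>+x. e2ennreal (- u x) \<partial>M)"

definition ext_integrable :: "'a measure \<Rightarrow> ('a \<Rightarrow> ereal) \<Rightarrow> bool" where
  "ext_integrable M u \<longleftrightarrow> u \<in> borel_measurable M \<and> (\<integral>\<^sup>+x. e2ennreal \<bar>u x\<bar> \<partial>M) < \<infinity>"

text \<open>
  For \<open>f\<close> in \<open>H2_plus\<close> the positive part of \<open>log |f|\<close> is integrable, so the undefined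
  difference \<open>\<infinity> - \<infinity>\<close> does not occur below.
\<close>

definition outer :: "((nat \<Rightarrow> complex) \<Rightarrow> complex) \<Rightarrow> bool" where
  "outer f \<longleftrightarrow> f \<in> H2_plus \<and>
     exp_ext (ext_integral torus_haar (\<lambda>x. log_ext (cmod (f x)))) =
       ereal (cmod (\<integral>x. f x \<partial>torus_haar))"

end

theory Submission
  imports Defs
begin

text \<open>
  Call a function analytic if its Fourier coefficients vanish off
  \<open>Z_plus\<close>, and fix an additive degree \<open>d\<close> on the frequencies that is positive on the nonzero
  elements of \<open>Z_plus\<close>. Split a real trigonometric polynomial \<open>P\<close> into its part \<open>P\<^sub>0\<close> of degree 0 and
  \<open>2 Re H\<close>, where \<open>H\<close> has positive degrees. If \<open>f\<close> is analytic, then \<open>f exp (- P\<^sub>0 / 2 - H)\<close> has no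
  negative degrees, and comparing the parts of degree 0 shows that its integral is
  \<open>f^(0) \<integral> exp (- P\<^sub>0 / 2)\<close>, where \<open>f^(0)\<close> is the mean of \<open>f\<close>. Hence
  \<open>|f^(0)| \<integral> exp (- P\<^sub>0 / 2) \<le> \<integral> |f| exp (- P / 2)\<close> (\<open>norm_fourier_0_le\<close>). For \<open>P\<close> take the Fejer
  means of \<open>log (|f|\<^sup>2 + \<epsilon>)\<close>: the right-hand side then tends to a number that is at most 1
  (\<open>exp_level_part_limit\<close>). With \<open>exp t \<ge> 1 + t\<close> this is Jensen's inequality
  \<open>2 log |f^(0)| \<le> \<integral> log (|f|\<^sup>2 + \<epsilon>)\<close> (\<open>jensen_regularized\<close>).

  If there is an outer \<open>g\<close> with \<open>w = |g|\<^sup>2\<close>, Jensen's inequality is an equality for \<open>g\<close> in the limit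
  \<open>\<epsilon> \<rightarrow> 0\<close>. Since \<open>exp t - 1 - t\<close> controls \<open>|t|\<close>, near equality makes the part of degree 0 of the
  logarithm nearly constant, so \<open>log w\<close> has no nonzero frequencies of degree 0
  (\<open>fourier_log_eq_0\<close>). This holds for every \<open>d\<close>, and a frequency with entries of both signs has
  degree 0 for a suitable \<open>d\<close> (\<open>exists_positive_grading_eq_0\<close>).

  Conversely, let the spectrum of \<open>u = log w\<close> lie in \<open>Z_plus \<union> - Z_plus\<close>. The Fejer mean \<open>u\<^sub>N\<close> of \<open>u\<close>
  is then \<open>2 Re D\<^sub>N\<close> with an analytic polynomial \<open>D\<^sub>N\<close>, so \<open>g\<^sub>N = exp D\<^sub>N\<close> is analytic,
  \<open>|g\<^sub>N|\<^sup>2 = exp u\<^sub>N\<close> is at most the Fejer mean of \<open>w\<close>, and \<open>g\<^sub>N\<close> has mean \<open>exp (u^(0) / 2)\<close>. The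
  midpoint of \<open>g\<^sub>j\<close> and \<open>g\<^sub>k\<close> has the same mean, so Jensen's inequality bounds it from below, while
  \<open>g\<^sub>j\<close> and \<open>g\<^sub>k\<close> are bounded from above; by the parallelogram law they must be close
  (\<open>L1_dist_outer_approx_le\<close>). So the \<open>g\<^sub>N\<close> form a Cauchy sequence in \<open>L\<^sup>1\<close>, and an almost everywhere
  limit of a subsequence is the outer function (\<open>exists_outer_function\<close>).
\<close>

section \<open>Characters and Fourier coefficients\<close>

abbreviation "lookup \<equiv> Poly_Mapping.lookup"
abbreviation "keys \<equiv> Poly_Mapping.keys"

interpretation torus: prob_space torus_haar
  by (rule prob_space_torus_haar)

lemma in_space_torus: "x \<in> space torus_haar \<longleftrightarrow> (\<forall>k. cmod (x k) = 1)"
  by (auto simp: torus_haar_def space_PiM PiE_iff space_circle_haar)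

lemma measurable_coordinate_circle: "(\<lambda>x. x k) \<in> torus_haar \<rightarrow>\<^sub>M circle_haar"
  unfolding torus_haar_def by (rule measurable_component_singleton) simp

lemma measurable_coordinate [measurable]: "(\<lambda>x. x k) \<in> borel_measurable torus_haar"
proof -
  have "(\<lambda>z. z) \<in> restrict_space borel (sphere 0 1) \<rightarrow>\<^sub>M (borel :: complex measure)"
    by (rule measurable_restrict_space1) simp
  then have "(\<lambda>z. z) \<in> circle_haar \<rightarrow>\<^sub>M (borel :: complex measure)"
    by (simp add: measurable_cong_sets[OF sets_circle_haar refl])
  from measurable_compose[OF measurable_coordinate_circle this] show ?thesis .
qed

lemma character_prod:
  assumes "finite A" "keys n \<subseteq> A"
  shows "character n x = (\<Prod>k\<in>A. x k powi lookup n k)"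
  unfolding character_def using assms
  by (intro prod.mono_neutral_left) (auto simp: in_keys_iff)

lemma measurable_cnj [measurable]: "cnj \<in> borel_measurable borel"
  by (intro borel_measurable_continuous_onI continuous_intros)

lemma measurable_powi [measurable]:
  "(\<lambda>z::complex. z powi m) \<in> borel_measurable borel"
  by (cases "m \<ge> 0") (simp_all add: power_int_def)

lemma measurable_character [measurable]: "character n \<in> borel_measurable torus_haar"
proof -
  have "(\<lambda>x. x k powi lookup n k) \<in> borel_measurable torus_haar" for k
    using measurable_compose[OF measurable_coordinate measurable_powi] .
  then show ?thesis
    unfolding character_def[abs_def] by (intro borel_measurable_prod)
qed

lemma norm_character: "x \<in> space torus_haar \<Longrightarrow> cmod (character n x) = 1"
  by (simp add: character_def prod_norm[symmetric] norm_power_int in_space_torus)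

lemma character_0 [simp]: "character 0 x = 1"
  by (simp add: character_def)

lemma character_add:
  assumes "x \<in> space torus_haar"
  shows "character (m + n) x = character m x * character n x"
proof -
  have nz: "x k \<noteq> 0" for k
    using assms by (metis in_space_torus norm_zero zero_neq_one)
  have "keys (m + n) \<subseteq> keys m \<union> keys n" by (rule Poly_Mapping.keys_add)
  then show ?thesis
    by (simp add: character_prod[of "keys m \<union> keys n"] lookup_add power_int_add nz prod.distrib)
qed

lemma character_uminus:
  assumes "x \<in> space torus_haar"
  shows "character (- n) x = cnj (character n x)"
proof -
  have "character (- n) x * character n x = 1"
    using character_add[OF assms, of "- n" n] by simp
  moreover have "cnj (character n x) * character n x = 1"
    using norm_character[OF assms, of n] by (simp add: mult.commute[of "cnj _"] complex_norm_square[symmetric])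
  ultimately show ?thesis
    by (metis mult_cancel_right norm_character[OF assms] norm_zero zero_neq_one)
qed

lemma character_diff:
  assumes "x \<in> space torus_haar"
  shows "character (m - n) x = character m x * cnj (character n x)"
  using character_add[OF assms, of m "- n"] character_uminus[OF assms] by simp

lemma integrable_character_mult:
  assumes "integrable torus_haar f"
  shows "integrable torus_haar (\<lambda>x. f x * character n x)"
    and "integrable torus_haar (\<lambda>x. f x * cnj (character n x))"
  by (rule Bochner_Integration.integrable_bound[OF assms];
      use assms in \<open>auto simp: norm_mult norm_character\<close>)+

lemma integrable_character [simp]: "integrable torus_haar (character n)"
  by (rule torus.integrable_const_bound[of _ 1]) (auto simp: norm_character)

text \<open>Rotating one coordinate on which the character depends by a suitable angle changes its
  sign, so by invariance its integral is its own negative.\<close>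

lemma integral_character: "(\<integral>x. character n x \<partial>torus_haar) = (if n = 0 then 1 else 0)"
proof (cases "n = 0")
  case True
  then show ?thesis by (simp add: torus.prob_space)
next
  case False
  then obtain j where j: "lookup n j \<noteq> 0"
    by (metis keys_eq_empty ex_in_conv in_keys_iff)
  \<comment> \<open>The power \<open>lookup n j\<close> of this rotation is \<open>cis pi = - 1\<close>.\<close>
  define a where "a k = (if k = j then cis (pi / lookup n j) else 1)" for k
  have a: "cmod (a k) = 1" for k by (simp add: a_def)
  have "character n a = (\<Prod>k\<in>keys n. if k = j then - 1 else 1)"
    unfolding character_def
    by (intro prod.cong refl) (use j in \<open>auto simp: a_def cis_power_int\<close>)
  also have "\<dots> = - 1"
    using j by (subst prod.delta) (auto simp: in_keys_iff)
  finally have na: "character n a = - 1" .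
  have rot: "character n (\<lambda>k. a k * x k) = - character n x" for x
    using na by (simp add: character_def power_int_mult_distrib prod.distrib)
  have meas: "(\<lambda>x k. a k * x k) \<in> torus_haar \<rightarrow>\<^sub>M torus_haar"
    unfolding torus_haar_def
  proof (rule measurable_PiM_single')
    show "(\<lambda>x. a k * x k) \<in> Pi\<^sub>M UNIV (\<lambda>_. circle_haar) \<rightarrow>\<^sub>M circle_haar" for k
      using measurable_compose[OF measurable_component_singleton[of k UNIV "\<lambda>_. circle_haar"]
          measurable_rotation[OF a, of k]] by simp
  qed (use a in \<open>auto simp: space_PiM space_circle_haar norm_mult\<close>)
  have "(\<integral>x. character n x \<partial>torus_haar) =
      (\<integral>x. character n x \<partial>distr torus_haar torus_haar (\<lambda>x k. a k * x k))"
    by (simp add: torus_haar_invariant[OF a])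
  also have "\<dots> = (\<integral>x. - character n x \<partial>torus_haar)"
    by (subst integral_distr[OF meas]) (simp_all add: rot)
  finally show ?thesis using False by simp
qed

lemma fourier_cong_AE:
  assumes [measurable]: "f \<in> borel_measurable torus_haar" "g \<in> borel_measurable torus_haar"
    and "AE x in torus_haar. f x = g x"
  shows "fourier f n = fourier g n"
  unfolding fourier_def
  by (rule integral_cong_AE) (use assms(3) in auto)

lemma fourier_cong:
  "(\<And>x. x \<in> space torus_haar \<Longrightarrow> f x = g x) \<Longrightarrow> fourier f n = fourier g n"
  unfolding fourier_def by (rule Bochner_Integration.integral_cong) auto

lemma fourier_0: "fourier f 0 = (\<integral>x. f x \<partial>torus_haar)"
  by (simp add: fourier_def)

lemma fourier_add:
  assumes "integrable torus_haar f" "integrable torus_haar g"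
  shows "fourier (\<lambda>x. f x + g x) n = fourier f n + fourier g n"
  unfolding fourier_def distrib_right
  by (rule Bochner_Integration.integral_add) (intro integrable_character_mult assms)+

lemma fourier_diff:
  assumes "integrable torus_haar f" "integrable torus_haar g"
  shows "fourier (\<lambda>x. f x - g x) n = fourier f n - fourier g n"
  unfolding fourier_def left_diff_distrib
  by (rule Bochner_Integration.integral_diff) (intro integrable_character_mult assms)+

lemma fourier_cmult: "fourier (\<lambda>x. c * f x) n = c * fourier f n"
  by (simp add: fourier_def mult.assoc)

lemma fourier_mult_character:
  "fourier (\<lambda>x. f x * character m x) n = fourier f (n - m)"
  unfolding fourier_def
  by (intro Bochner_Integration.integral_cong) (simp_all add: character_diff mult_ac)

lemma fourier_sum:
  assumes "\<And>i. i \<in> A \<Longrightarrow> integrable torus_haar (f i)"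
  shows "fourier (\<lambda>x. \<Sum>i\<in>A. f i x) n = (\<Sum>i\<in>A. fourier (f i) n)"
  unfolding fourier_def sum_distrib_right
  by (intro Bochner_Integration.integral_sum integrable_character_mult assms)

lemma norm_fourier_le: "cmod (fourier f n) \<le> (\<integral>x. cmod (f x) \<partial>torus_haar)"
proof -
  have "cmod (fourier f n) \<le> (\<integral>x. cmod (f x * cnj (character n x)) \<partial>torus_haar)"
    unfolding fourier_def by (rule integral_norm_bound)
  also have "\<dots> = (\<integral>x. cmod (f x) \<partial>torus_haar)"
    by (intro Bochner_Integration.integral_cong) (auto simp: norm_mult norm_character)
  finally show ?thesis .
qed

lemma fourier_of_real_uminus:
  "fourier (\<lambda>x. complex_of_real (u x)) (- n) = cnj (fourier (\<lambda>x. complex_of_real (u x)) n)"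
proof -
  have "fourier (\<lambda>x. complex_of_real (u x)) (- n) =
      (\<integral>x. cnj (complex_of_real (u x) * cnj (character n x)) \<partial>torus_haar)"
    unfolding fourier_def
    by (intro Bochner_Integration.integral_cong) (auto simp: character_uminus)
  then show ?thesis unfolding fourier_def by (simp only: Bochner_Integration.integral_cnj)
qed

lemma fourier_character: "fourier (character m) n = (if m = n then 1 else 0)"
proof -
  have "fourier (character m) n = (\<integral>x. character (m - n) x \<partial>torus_haar)"
    unfolding fourier_def
    by (intro Bochner_Integration.integral_cong) (auto simp: character_diff)
  then show ?thesis by (simp add: integral_character)
qed

text \<open>Trigonometric polynomials with prescribed frequencies and coefficients. The predicate
  \<open>trig_poly\<close> below describes the same functions without naming frequencies, which is more
  convenient for closure properties.\<close>

definition trig :: "(nat \<Rightarrow>\<^sub>0 int) set \<Rightarrow> ((nat \<Rightarrow>\<^sub>0 int) \<Rightarrow> complex) \<Rightarrow> (nat \<Rightarrow> complex) \<Rightarrow> complex" where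
  "trig A c x = (\<Sum>n\<in>A. c n * character n x)"

lemma measurable_trig [measurable]: "trig A c \<in> borel_measurable torus_haar"
  unfolding trig_def[abs_def] by measurable

lemma norm_trig_le: "x \<in> space torus_haar \<Longrightarrow> cmod (trig A c x) \<le> (\<Sum>n\<in>A. cmod (c n))"
  unfolding trig_def by (rule order.trans[OF norm_sum]) (simp add: norm_mult norm_character)

lemma integrable_trig [simp]: "integrable torus_haar (trig A c)"
  by (rule torus.integrable_const_bound[of _ "\<Sum>n\<in>A. cmod (c n)"]) (auto simp: norm_trig_le)

lemma fourier_trig: "finite A \<Longrightarrow> fourier (trig A c) n = (if n \<in> A then c n else 0)"
  unfolding trig_def[abs_def]
  by (subst fourier_sum) (auto simp: fourier_cmult fourier_character if_distrib[of "(*) _"] cong: if_cong)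

section \<open>Density of trigonometric polynomials\<close>

text \<open>The rule \<open>cong\<close> identifies functions that agree on the torus, since the characters are
  multiplicative only there: at points with a coordinate 0 the rules for integer powers fail.\<close>

inductive trig_poly :: "((nat \<Rightarrow> complex) \<Rightarrow> complex) \<Rightarrow> bool" where
  character: "trig_poly (character n)"
| scale: "trig_poly f \<Longrightarrow> trig_poly (\<lambda>x. c * f x)"
| add: "trig_poly f \<Longrightarrow> trig_poly g \<Longrightarrow> trig_poly (\<lambda>x. f x + g x)"
| cong: "trig_poly f \<Longrightarrow> (\<And>x. x \<in> space torus_haar \<Longrightarrow> g x = f x) \<Longrightarrow> trig_poly g"

lemma trig_poly_const: "trig_poly (\<lambda>x. c)"
  by (rule trig_poly.cong[OF trig_poly.scale[OF trig_poly.character[of 0], of c]]) simp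

lemma trig_poly_mult_character: "trig_poly f \<Longrightarrow> trig_poly (\<lambda>x. f x * character m x)"
proof (induction rule: trig_poly.induct)
  case (character n)
  show ?case
    by (rule trig_poly.cong[OF trig_poly.character[of "n + m"]]) (simp add: character_add)
next
  case (scale f c)
  show ?case
    by (rule trig_poly.cong[OF trig_poly.scale[OF scale.IH, of c]]) simp
next
  case (add f g)
  show ?case
    by (rule trig_poly.cong[OF trig_poly.add[OF add.IH]]) (simp add: algebra_simps)
next
  case (cong f g)
  show ?case by (rule trig_poly.cong[OF cong.IH]) (simp add: cong.hyps)
qed

lemma trig_poly_mult: "trig_poly g \<Longrightarrow> trig_poly f \<Longrightarrow> trig_poly (\<lambda>x. f x * g x)"
proof (induction rule: trig_poly.induct)
  case (character n)
  then show ?case by (rule trig_poly_mult_character)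
next
  case (scale g c)
  show ?case
    by (rule trig_poly.cong[OF trig_poly.scale[OF scale.IH[OF scale.prems], of c]]) simp
next
  case (add g h)
  show ?case
    by (rule trig_poly.cong[OF trig_poly.add[OF add.IH(1)[OF add.prems] add.IH(2)[OF add.prems]]])
       (simp add: algebra_simps)
next
  case (cong g h)
  show ?case by (rule trig_poly.cong[OF cong.IH[OF cong.prems]]) (simp add: cong.hyps)
qed

lemma trig_poly_measurable: "trig_poly f \<Longrightarrow> f \<in> borel_measurable torus_haar"
proof (induction rule: trig_poly.induct)
  case (cong f g)
  then show ?case using measurable_cong[of torus_haar g f borel] by simp
qed auto

lemma trig_poly_bounded:
  "trig_poly f \<Longrightarrow> \<exists>B\<ge>0. \<forall>x\<in>space torus_haar. cmod (f x) \<le> B"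
proof (induction rule: trig_poly.induct)
  case (character n)
  then show ?case by (intro exI[of _ 1]) (simp add: norm_character)
next
  case (scale f c)
  then obtain B where "B \<ge> 0" "\<forall>x\<in>space torus_haar. cmod (f x) \<le> B" by blast
  then show ?case
    by (intro exI[of _ "cmod c * B"]) (auto simp: norm_mult intro!: mult_left_mono)
next
  case (add f g)
  then obtain B C where "B \<ge> 0" "\<forall>x\<in>space torus_haar. cmod (f x) \<le> B"
    "C \<ge> 0" "\<forall>x\<in>space torus_haar. cmod (g x) \<le> C" by blast
  then show ?case
    by (intro exI[of _ "B + C"]) (auto intro!: norm_triangle_mono)
qed auto

lemma integrable_trig_poly: "trig_poly f \<Longrightarrow> integrable torus_haar f"
  using trig_poly_bounded[of f] trig_poly_measurable[of f]
  by (auto intro!: torus.integrable_const_bound)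

text \<open>Membership in the \<open>L\<^sup>1\<close> closure of the trigonometric polynomials. That every integrable
  function belongs to it is proved along the usual chain: continuous functions of one coordinate,
  cylinders over closed sets, measurable sets, integrable functions.\<close>

definition approximable :: "((nat \<Rightarrow> complex) \<Rightarrow> complex) \<Rightarrow> bool" where
  "approximable f \<longleftrightarrow> integrable torus_haar f \<and>
     (\<forall>e>0. \<exists>p. trig_poly p \<and> (\<integral>x. cmod (f x - p x) \<partial>torus_haar) < e)"

lemma L1_triangle:
  assumes [simp]: "integrable torus_haar f" "integrable torus_haar g" "integrable torus_haar h"
  shows "(\<integral>x. cmod (f x - h x) \<partial>torus_haar) \<le>
    (\<integral>x. cmod (f x - g x) \<partial>torus_haar) + (\<integral>x. cmod (g x - h x) \<partial>torus_haar)"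
proof -
  have "(\<integral>x. cmod (f x - h x) \<partial>torus_haar) \<le>
      (\<integral>x. cmod (f x - g x) + cmod (g x - h x) \<partial>torus_haar)"
    by (intro integral_mono) (auto intro: order.trans[OF _ norm_triangle_ineq])
  then show ?thesis by simp
qed

lemma approximable_limit:
  assumes f: "integrable torus_haar f"
    and ex: "\<And>e. 0 < e \<Longrightarrow> \<exists>g. approximable g \<and> (\<integral>x. cmod (f x - g x) \<partial>torus_haar) < e"
  shows "approximable f"
  unfolding approximable_def
proof (intro conjI f allI impI)
  fix e :: real assume "e > 0"
  then obtain g where g: "approximable g" "(\<integral>x. cmod (f x - g x) \<partial>torus_haar) < e / 2"
    using ex[of "e / 2"] by auto
  then obtain p where p: "trig_poly p" "(\<integral>x. cmod (g x - p x) \<partial>torus_haar) < e / 2"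
    unfolding approximable_def using \<open>e > 0\<close> half_gt_zero by blast
  have "(\<integral>x. cmod (f x - p x) \<partial>torus_haar) < e"
    using L1_triangle[OF f _ integrable_trig_poly[OF p(1)], of g] g p
    unfolding approximable_def by auto
  with p(1) show "\<exists>p. trig_poly p \<and> (\<integral>x. cmod (f x - p x) \<partial>torus_haar) < e" by blast
qed

lemma approximable_trig_poly: "trig_poly p \<Longrightarrow> approximable p"
  unfolding approximable_def by (auto simp: integrable_trig_poly intro!: exI[of _ p])

lemma approximable_dominated_limit:
  assumes s: "\<And>i. approximable (s i)" and f: "integrable torus_haar f"
    and w: "integrable torus_haar w"
    and lim: "\<And>x. x \<in> space torus_haar \<Longrightarrow> (\<lambda>i. s i x) \<longlonglongrightarrow> f x"
    and bound: "\<And>i x. x \<in> space torus_haar \<Longrightarrow> cmod (s i x) \<le> w x"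
  shows "approximable f"
proof (rule approximable_limit[OF f])
  have si: "integrable torus_haar (s i)" for i
    using s unfolding approximable_def by blast
  have "(\<lambda>i. \<integral>x. cmod (f x - s i x) \<partial>torus_haar) \<longlonglongrightarrow> (\<integral>x. 0 \<partial>torus_haar)"
  proof (rule integral_dominated_convergence[where w = "\<lambda>x. cmod (f x) + w x"])
    show "AE x in torus_haar. (\<lambda>i. cmod (f x - s i x)) \<longlonglongrightarrow> 0"
      using lim by (intro AE_I2) (auto intro!: tendsto_eq_intros)
    show "AE x in torus_haar. norm (cmod (f x - s i x)) \<le> cmod (f x) + w x" for i
      using bound by (intro AE_I2) (auto intro!: order.trans[OF norm_triangle_ineq4] add_left_mono)
  qed (use f si w in auto)
  then have *: "(\<lambda>i. \<integral>x. cmod (f x - s i x) \<partial>torus_haar) \<longlonglongrightarrow> 0" by simp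
  fix e :: real assume "e > 0"
  from order_tendstoD(2)[OF * this] obtain i where
    "(\<integral>x. cmod (f x - s i x) \<partial>torus_haar) < e"
    by (auto simp: eventually_sequentially)
  with s show "\<exists>g. approximable g \<and> (\<integral>x. cmod (f x - g x) \<partial>torus_haar) < e" by blast
qed

lemma approximable_add:
  assumes "approximable f" "approximable g"
  shows "approximable (\<lambda>x. f x + g x)"
  unfolding approximable_def
proof (intro conjI allI impI)
  show "integrable torus_haar (\<lambda>x. f x + g x)"
    using assms unfolding approximable_def by simp
  fix e :: real assume "e > 0"
  then obtain p q where p: "trig_poly p" "(\<integral>x. cmod (f x - p x) \<partial>torus_haar) < e / 2"
    and q: "trig_poly q" "(\<integral>x. cmod (g x - q x) \<partial>torus_haar) < e / 2"
    using assms unfolding approximable_def by (meson half_gt_zero)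
  have [simp]: "integrable torus_haar f" "integrable torus_haar g"
    "integrable torus_haar p" "integrable torus_haar q"
    using assms p q integrable_trig_poly unfolding approximable_def by auto
  have "(\<integral>x. cmod (f x + g x - (p x + q x)) \<partial>torus_haar) \<le>
      (\<integral>x. cmod (f x - p x) + cmod (g x - q x) \<partial>torus_haar)"
    by (intro integral_mono) (auto intro: norm_diff_triangle_ineq)
  also have "\<dots> < e" using p q by simp
  finally show "\<exists>p. trig_poly p \<and> (\<integral>x. cmod (f x + g x - p x) \<partial>torus_haar) < e"
    using trig_poly.add[OF p(1) q(1)] by blast
qed

text \<open>The factors are approximated one after the other: first \<open>g\<close>, which is multiplied by the
  bounded \<open>f\<close>; then \<open>f\<close>, with an error small compared to the bound of the polynomial just
  chosen.\<close>

lemma approximable_mult: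
  assumes f: "approximable f" and g: "approximable g"
    and B: "B \<ge> 0" "\<And>x. x \<in> space torus_haar \<Longrightarrow> cmod (f x) \<le> B"
  shows "approximable (\<lambda>x. f x * g x)"
proof -
  have [simp]: "integrable torus_haar f" "integrable torus_haar g"
    using f g unfolding approximable_def by auto
  have [measurable]: "f \<in> borel_measurable torus_haar" "g \<in> borel_measurable torus_haar"
    by (simp_all add: borel_measurable_integrable)
  have fg: "integrable torus_haar (\<lambda>x. f x * g x)"
    by (rule Bochner_Integration.integrable_bound[of _ "\<lambda>x. of_real B * g x"])
       (auto simp: norm_mult B intro!: mult_right_mono)
  show ?thesis
    unfolding approximable_def
  proof (intro conjI fg allI impI)
    fix e :: real assume e: "e > 0"
    have half: "b * (e / (2 * b)) = e / 2" if "b > 0" for b :: real using that by simp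
    define e1 where "e1 = e / (2 * (B + 1))"
    have e1: "e1 > 0" using e B by (simp add: e1_def)
    then obtain q where q: "trig_poly q" "(\<integral>x. cmod (g x - q x) \<partial>torus_haar) < e1"
      using g unfolding approximable_def by blast
    obtain C where C: "C \<ge> 0" "\<And>x. x \<in> space torus_haar \<Longrightarrow> cmod (q x) \<le> C"
      using trig_poly_bounded[OF q(1)] by blast
    define e2 where "e2 = e / (2 * (C + 1))"
    have e2: "e2 > 0" using e C by (simp add: e2_def)
    then obtain p where p: "trig_poly p" "(\<integral>x. cmod (f x - p x) \<partial>torus_haar) < e2"
      using f unfolding approximable_def by blast
    have [simp]: "integrable torus_haar p" "integrable torus_haar q"
      using p q integrable_trig_poly by auto
    have pq: "trig_poly (\<lambda>x. p x * q x)" by (rule trig_poly_mult[OF q(1) p(1)])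
    have [simp]: "integrable torus_haar (\<lambda>x. p x * q x)" by (rule integrable_trig_poly[OF pq])
    have "(\<integral>x. cmod (f x * g x - p x * q x) \<partial>torus_haar) \<le>
        (\<integral>x. (B + 1) * cmod (g x - q x) + (C + 1) * cmod (f x - p x) \<partial>torus_haar)"
    proof (intro integral_mono)
      fix x assume x: "x \<in> space torus_haar"
      have "f x * g x - p x * q x = f x * (g x - q x) + q x * (f x - p x)"
        by (simp add: algebra_simps)
      then have "cmod (f x * g x - p x * q x) \<le>
          cmod (f x) * cmod (g x - q x) + cmod (q x) * cmod (f x - p x)"
        by (metis norm_mult norm_triangle_ineq)
      also have "\<dots> \<le> (B + 1) * cmod (g x - q x) + (C + 1) * cmod (f x - p x)"
        using B(2)[OF x] C(2)[OF x] by (intro add_mono mult_right_mono) auto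
      finally show "cmod (f x * g x - p x * q x) \<le> \<dots>" .
    qed (auto simp: fg)
    also have "\<dots> = (B + 1) * (\<integral>x. cmod (g x - q x) \<partial>torus_haar) +
        (C + 1) * (\<integral>x. cmod (f x - p x) \<partial>torus_haar)" by simp
    also have "\<dots> < (B + 1) * e1 + (C + 1) * e2"
      using p q B C by (intro add_strict_mono mult_strict_left_mono) auto
    also have "(B + 1) * e1 = e / 2" unfolding e1_def using B(1) by (intro half) simp
    also have "(C + 1) * e2 = e / 2" unfolding e2_def using C(1) by (intro half) simp
    also have "e / 2 + e / 2 = e" by simp
    finally show "\<exists>p. trig_poly p \<and> (\<integral>x. cmod (f x * g x - p x) \<partial>torus_haar) < e"
      using pq by blast
  qed
qed

lemma approximable_scale: "approximable f \<Longrightarrow> approximable (\<lambda>x. c * f x)"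
  by (rule approximable_mult[where B = "cmod c"])
     (auto intro: approximable_trig_poly trig_poly_const)

text \<open>On the circle \<open>cnj z = 1 / z\<close>, so a real linear form in \<open>z\<close> is a combination of the characters
  \<open>z\<close> and \<open>1 / z\<close>.\<close>

lemma trig_poly_coordinate_polynomial:
  assumes "real_polynomial_function h"
  shows "trig_poly (\<lambda>x. complex_of_real (h (x k)))"
  using assms
proof (induction rule: real_polynomial_function.induct)
  case (linear f)
  interpret bounded_linear f by fact
  have f: "f z = Re z * f 1 + Im z * f \<i>" for z
  proof -
    have "f z = f (Re z *\<^sub>R 1 + Im z *\<^sub>R \<i>)"
      by (rule arg_cong[of _ _ f]) (simp add: complex_eq_iff)
    then show ?thesis by (simp add: add scale)
  qed
  let ?e = "Poly_Mapping.single k (1::int)"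
  \<comment> \<open>The form \<open>f\<close> is \<open>z \<mapsto> 2 Re (?a z)\<close>.\<close>
  let ?a = "(complex_of_real (f 1) - \<i> * complex_of_real (f \<i>)) / 2"
  have e: "character ?e x = x k" for x by (simp add: character_def)
  have "trig_poly (\<lambda>x. ?a * character ?e x + cnj ?a * character (- ?e) x)"
    by (intro trig_poly.intros)
  then show ?case
  proof (rule trig_poly.cong)
    fix x assume "x \<in> space torus_haar"
    then have "?a * character ?e x + cnj ?a * character (- ?e) x = ?a * x k + cnj (?a * x k)"
      by (simp add: character_uminus e)
    then show "complex_of_real (f (x k)) = ?a * character ?e x + cnj ?a * character (- ?e) x"
      by (subst f) (simp add: complex_eq_iff field_simps)
  qed
next
  case (const c)
  show ?case by (rule trig_poly_const)
next
  case (add f g)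
  then show ?case by (simp add: trig_poly.add)
next
  case (mult f g)
  then show ?case by (simp add: trig_poly_mult)
qed

lemma approximable_continuous_coordinate:
  assumes h: "continuous_on (sphere 0 1) (h :: complex \<Rightarrow> real)" and [measurable]: "h \<in> borel_measurable borel"
  shows "approximable (\<lambda>x. complex_of_real (h (x k)))"
proof -
  have "bounded (h ` sphere 0 1)"
    by (intro compact_imp_bounded compact_continuous_image h compact_sphere)
  then obtain B where "\<forall>y\<in>h ` sphere 0 1. norm y \<le> B"
    unfolding bounded_iff by blast
  then have B: "\<bar>h z\<bar> \<le> B" if "cmod z = 1" for z
    using that by simp
  have int: "integrable torus_haar (\<lambda>x. complex_of_real (h (x k)))"
    by (rule torus.integrable_const_bound[of _ B]) (auto simp: in_space_torus B)
  show ?thesis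
    unfolding approximable_def
  proof (intro conjI int allI impI)
    fix e :: real assume "e > 0"
    then obtain g where g: "real_polynomial_function g"
        "\<And>z. z \<in> sphere 0 1 \<Longrightarrow> \<bar>h z - g z\<bar> < e / 2"
      using Stone_Weierstrass_real_polynomial_function[OF compact_sphere h, of "e / 2"]
      by (metis half_gt_zero)
    let ?p = "\<lambda>x. complex_of_real (g (x k))"
    have p: "trig_poly ?p" by (rule trig_poly_coordinate_polynomial[OF g(1)])
    have "(\<integral>x. cmod (complex_of_real (h (x k)) - ?p x) \<partial>torus_haar) \<le> (\<integral>x. e / 2 \<partial>torus_haar)"
    proof (intro integral_mono)
      fix x assume "x \<in> space torus_haar"
      then have "\<bar>h (x k) - g (x k)\<bar> < e / 2" by (intro g(2)) (simp add: in_space_torus)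
      then show "cmod (complex_of_real (h (x k)) - ?p x) \<le> e / 2"
        by (simp add: of_real_diff[symmetric] del: of_real_diff)
    qed (use int integrable_trig_poly[OF p] in auto)
    also have "\<dots> < e" using \<open>e > 0\<close> by (simp add: torus.prob_space)
    finally show "\<exists>p. trig_poly p \<and> (\<integral>x. cmod (complex_of_real (h (x k)) - p x) \<partial>torus_haar) < e"
      using p by blast
  qed
qed

definition approximable_set :: "(nat \<Rightarrow> complex) set \<Rightarrow> bool" where
  "approximable_set A \<longleftrightarrow> A \<in> sets torus_haar \<and> approximable (indicator A)"

lemma integrable_indicator_torus:
  "A \<in> sets torus_haar \<Longrightarrow> integrable torus_haar (indicator A :: _ \<Rightarrow> complex)"
  by (rule torus.integrable_const_bound[of _ 1]) (auto simp: indicator_def)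

lemma approximable_cong:
  assumes "approximable f" "\<And>x. x \<in> space torus_haar \<Longrightarrow> g x = f x"
  shows "approximable g"
proof -
  have "(\<integral>x. cmod (f x - p x) \<partial>torus_haar) = (\<integral>x. cmod (g x - p x) \<partial>torus_haar)" for p
    by (rule Bochner_Integration.integral_cong) (auto simp: assms(2))
  then show ?thesis
    using assms(1) Bochner_Integration.integrable_cong[of torus_haar torus_haar g f] assms(2)
    unfolding approximable_def by auto
qed

lemma approximable_set_compl:
  assumes "approximable_set A"
  shows "approximable_set (space torus_haar - A)"
proof -
  have "approximable (\<lambda>x. 1 + (- 1) * indicator A x)"
    using assms unfolding approximable_set_def
    by (intro approximable_add approximable_scale approximable_trig_poly[OF trig_poly_const]) auto
  then have "approximable (indicator (space torus_haar - A))"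
    by (rule approximable_cong) (auto simp: indicator_def)
  then show ?thesis using assms by (auto simp: approximable_set_def)
qed

lemma approximable_set_Un:
  assumes A: "approximable_set A" and B: "approximable_set B"
  shows "approximable_set (A \<union> B)"
proof -
  note AB = conjunct2[OF A[unfolded approximable_set_def]] conjunct2[OF B[unfolded approximable_set_def]]
  have "approximable (\<lambda>x. indicator A x * indicator B x)"
    by (rule approximable_mult[OF AB, where B = 1]) (auto simp: indicator_def)
  then have "approximable (\<lambda>x. indicator A x + (indicator B x + (- 1) * (indicator A x * indicator B x)))"
    by (intro approximable_add approximable_scale AB)
  then have "approximable (indicator (A \<union> B))"
    by (rule approximable_cong) (auto simp: indicator_def)
  then show ?thesis using A B by (auto simp: approximable_set_def)
qed

lemma approximable_set_empty: "approximable_set {}"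
  using approximable_trig_poly[OF trig_poly_const[of 0]]
  by (auto simp: approximable_set_def intro: approximable_cong)

lemma approximable_set_UN:
  assumes A: "\<And>i::nat. approximable_set (A i)"
  shows "approximable_set (\<Union>i. A i)"
proof -
  define U where "U n = (\<Union>i<n. A i)" for n
  have U: "approximable_set (U n)" for n
    by (induction n) (auto simp: U_def approximable_set_empty lessThan_Suc approximable_set_Un A)
  have [measurable]: "(\<Union>i. A i) \<in> sets torus_haar"
    using A by (auto simp: approximable_set_def)
  have "approximable (indicator (\<Union>i. A i))"
  proof (rule approximable_dominated_limit[where s = "\<lambda>n. indicator (U n)" and w = "\<lambda>_. 1"])
    fix x
    show "(\<lambda>i. indicator (U i) x :: complex) \<longlonglongrightarrow> indicator (\<Union>i. A i) x"
      unfolding U_def by (rule LIMSEQ_indicator_UN)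
  qed (use U in \<open>auto simp: approximable_set_def integrable_indicator_torus indicator_def\<close>)
  then show ?thesis by (simp add: approximable_set_def)
qed

text \<open>The indicator of a nonempty closed set is the decreasing limit of the continuous functions
  \<open>max 0 (1 - m * infdist z C)\<close>.\<close>

lemma approximable_set_closed_cylinder:
  assumes C: "closed C"
  shows "approximable_set {x \<in> space torus_haar. x k \<in> C}"
proof (cases "C = {}")
  case True
  then show ?thesis using approximable_set_empty by simp
next
  case False
  let ?A = "{x \<in> space torus_haar. x k \<in> C}"
  have [measurable]: "C \<in> sets borel" using C by simp
  have A: "?A \<in> sets torus_haar" by measurable
  define h where "h m z = max 0 (1 - real m * infdist z C)" for m z
  have ch: "continuous_on S (h m)" for S m
    unfolding h_def by (intro continuous_intros)
  have "approximable (indicator ?A)"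
  proof (rule approximable_dominated_limit[where s = "\<lambda>m x. complex_of_real (h m (x k))" and w = "\<lambda>_. 1"])
    show "approximable (\<lambda>x. complex_of_real (h m (x k)))" for m
      by (intro approximable_continuous_coordinate borel_measurable_continuous_onI ch)
    show "cmod (complex_of_real (h m (x k))) \<le> 1" for m x
      by (auto simp: h_def infdist_nonneg)
    fix x assume x: "x \<in> space torus_haar"
    show "(\<lambda>m. complex_of_real (h m (x k))) \<longlonglongrightarrow> indicator ?A x"
    proof (cases "x k \<in> C")
      case True
      then show ?thesis using x by (simp add: h_def)
    next
      case False
      then have pos: "infdist (x k) C > 0"
        using in_closed_iff_infdist_zero[OF C \<open>C \<noteq> {}\<close>, of "x k"] infdist_nonneg[of "x k" C]
        by linarith
      obtain M :: nat where M: "1 < real M * infdist (x k) C"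
        using reals_Archimedean3[OF pos] by blast
      have "h m (x k) = 0" if "m \<ge> M" for m
      proof -
        have "real M * infdist (x k) C \<le> real m * infdist (x k) C"
          using that pos by (intro mult_right_mono) auto
        with M show ?thesis by (simp add: h_def)
      qed
      then have "eventually (\<lambda>m. complex_of_real (h m (x k)) = indicator ?A x) sequentially"
        using False by (auto simp: eventually_sequentially)
      then show ?thesis by (rule tendsto_eventually)
    qed
  qed (auto simp: A integrable_indicator_torus)
  with A show ?thesis by (simp add: approximable_set_def)
qed

lemma approximable_set_cylinder:
  assumes "B \<in> sets borel"
  shows "approximable_set {x \<in> space torus_haar. x k \<in> B}"
proof -
  have "B \<in> sigma_sets UNIV (Collect closed)"
    using assms by (simp add: borel_eq_closed)
  then show ?thesis
  proof (induction rule: sigma_sets.induct)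
    case (Basic C)
    then show ?case by (auto intro: approximable_set_closed_cylinder)
  next
    case Empty
    then show ?case using approximable_set_empty by simp
  next
    case (Compl B)
    have "{x \<in> space torus_haar. x k \<in> UNIV - B} =
        space torus_haar - {x \<in> space torus_haar. x k \<in> B}" by auto
    then show ?case using approximable_set_compl[OF Compl.IH] by simp
  next
    case (Union B)
    have "{x \<in> space torus_haar. x k \<in> (\<Union>i. B i)} =
        (\<Union>i. {x \<in> space torus_haar. x k \<in> B i})" by auto
    then show ?case using approximable_set_UN[OF Union.IH] by simp
  qed
qed

text \<open>Approximable sets form a \<open>\<sigma>\<close>-algebra: products of bounded approximable functions are
  approximable, which gives intersections, and dominated convergence gives countable unions. So it
  suffices to have the cylinders.\<close>

lemma approximable_set_measurable:
  assumes "A \<in> sets torus_haar"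
  shows "approximable_set A"
proof -
  have sp: "(\<Pi>\<^sub>E i\<in>UNIV. space circle_haar) = space torus_haar"
    by (simp add: torus_haar_def space_PiM)
  have "A \<in> sigma_sets (space torus_haar)
      {{f \<in> space torus_haar. f i \<in> B} | i B. B \<in> sets circle_haar}"
    using assms unfolding torus_haar_def sets_PiM_single by (simp add: sp torus_haar_def[symmetric])
  then show ?thesis
  proof (induction rule: sigma_sets.induct)
    case (Basic D)
    then obtain i B where D: "D = {f \<in> space torus_haar. f i \<in> B}" "B \<in> sets circle_haar" by blast
    then obtain B' where "B' \<in> sets borel" "B = sphere 0 1 \<inter> B'"
      by (auto simp: sets_circle_haar sets_restrict_space)
    then have "D = {f \<in> space torus_haar. f i \<in> B'}" using D by (auto simp: in_space_torus)
    then show ?case using approximable_set_cylinder[OF \<open>B' \<in> sets borel\<close>] by simp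
  qed (auto intro: approximable_set_empty approximable_set_compl approximable_set_UN)
qed

theorem approximable_integrable:
  "integrable torus_haar f \<Longrightarrow> approximable f"
proof (induction rule: integrable_induct)
  case (base A c)
  have "approximable (\<lambda>x. c * indicator A x)"
    using approximable_set_measurable[OF base(1)] unfolding approximable_set_def
    by (blast intro: approximable_scale)
  then show ?case by (rule approximable_cong) (simp add: indicator_def)
next
  case (add f g)
  then show ?case by (intro approximable_add)
next
  case (lim f s)
  then show ?case
    by (intro approximable_dominated_limit[of s f "\<lambda>x. 2 * cmod (f x)"]) auto
qed

section \<open>Fejer means\<close>

text \<open>With \<open>I\<close> constant equal to \<open>{0..<N}\<close> these are cubes that grow in side length and in dimension;
  they serve as a Foelner sequence of the group of frequencies. General side sets \<open>I\<close> are admitted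
  because the intersection of a cube with a translate is again a box.\<close>

definition lattice_box :: "nat \<Rightarrow> (nat \<Rightarrow> int set) \<Rightarrow> (nat \<Rightarrow>\<^sub>0 int) set" where
  "lattice_box N I = {m. keys m \<subseteq> {..<N} \<and> (\<forall>k<N. lookup m k \<in> I k)}"

lemma bij_betw_lattice_box:
  "bij_betw (\<lambda>m. restrict (lookup m) {..<N}) (lattice_box N I) (PiE {..<N} I)"
proof (rule bij_betw_imageI)
  show "inj_on (\<lambda>m. restrict (lookup m) {..<N}) (lattice_box N I)"
  proof (rule inj_onI, rule poly_mapping_eqI)
    fix m m' k assume m: "m \<in> lattice_box N I" "m' \<in> lattice_box N I"
      and eq: "restrict (lookup m) {..<N} = restrict (lookup m') {..<N}"
    show "lookup m k = lookup m' k"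
    proof (cases "k < N")
      case True
      then show ?thesis using fun_cong[OF eq, of k] by simp
    next
      case False
      then have "k \<notin> keys m" "k \<notin> keys m'" using m by (auto simp: lattice_box_def)
      then show ?thesis by (simp add: in_keys_iff)
    qed
  qed
  show "(\<lambda>m. restrict (lookup m) {..<N}) ` lattice_box N I = PiE {..<N} I"
  proof (intro equalityI subsetI)
    fix f assume f: "f \<in> PiE {..<N} I"
    let ?m = "Poly_Mapping.Abs_poly_mapping (\<lambda>k. if k < N then f k else 0)"
    have fin: "finite {k. (if k < N then f k else 0) \<noteq> 0}"
      by (rule finite_subset[of _ "{..<N}"]) auto
    then have l: "lookup ?m = (\<lambda>k. if k < N then f k else 0)" by simp
    have "f = restrict (lookup ?m) {..<N}"
      using f by (auto simp: l PiE_iff extensional_def restrict_def)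
    moreover have "?m \<in> lattice_box N I"
      using f by (auto simp: lattice_box_def in_keys_iff l PiE_iff split: if_splits)
    ultimately show "f \<in> (\<lambda>m. restrict (lookup m) {..<N}) ` lattice_box N I" by blast
  qed (auto simp: lattice_box_def restrict_def split: if_splits)
qed

lemma card_lattice_box: "card (lattice_box N I) = (\<Prod>k<N. card (I k))"
  by (simp add: bij_betw_same_card[OF bij_betw_lattice_box] card_PiE)

lemma finite_lattice_box: "(\<And>k. finite (I k)) \<Longrightarrow> finite (lattice_box N I)"
  by (simp add: bij_betw_finite[OF bij_betw_lattice_box] finite_PiE)

abbreviation cube :: "nat \<Rightarrow> (nat \<Rightarrow>\<^sub>0 int) set" where
  "cube N \<equiv> lattice_box N (\<lambda>_. {0..<int N})"

lemma finite_cube [simp]: "finite (cube N)"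
  by (rule finite_lattice_box) simp

lemma card_cube: "card (cube N) = N ^ N"
  by (simp add: card_lattice_box)

lemma cube_nonempty [simp]: "cube N \<noteq> {}"
proof -
  have "0 \<in> cube N" by (simp add: lattice_box_def)
  then show ?thesis by blast
qed

definition overlap :: "nat \<Rightarrow> (nat \<Rightarrow>\<^sub>0 int) \<Rightarrow> (nat \<Rightarrow>\<^sub>0 int) set" where
  "overlap N n = {m \<in> cube N. m + n \<in> cube N}"

definition freqs :: "nat \<Rightarrow> (nat \<Rightarrow>\<^sub>0 int) set" where
  "freqs N = (\<lambda>(m, m'). m - m') ` (cube N \<times> cube N)"

text \<open>The Fourier coefficients of the Fejer kernel: the proportion of the cube that stays in the cube
  under translation by \<open>n\<close>.\<close>

definition fejer :: "nat \<Rightarrow> (nat \<Rightarrow>\<^sub>0 int) \<Rightarrow> real" where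
  "fejer N n = card (overlap N n) / card (cube N)"

lemma finite_overlap [simp]: "finite (overlap N n)"
  unfolding overlap_def by simp

lemma finite_freqs [simp]: "finite (freqs N)"
  unfolding freqs_def by simp

lemma overlap_uminus: "(\<lambda>m. m + n) ` overlap N n = overlap N (- n)"
proof (intro equalityI subsetI)
  fix m assume m: "m \<in> overlap N (- n)"
  then have "m - n \<in> overlap N n" "m = (m - n) + n" by (auto simp: overlap_def)
  then show "m \<in> (\<lambda>m. m + n) ` overlap N n" by blast
qed (auto simp: overlap_def)

lemma fejer_uminus: "fejer N (- n) = fejer N n"
  unfolding fejer_def overlap_uminus[symmetric] by (simp add: card_image)

lemma fejer_0 [simp]: "fejer N 0 = 1"
  by (simp add: fejer_def overlap_def)

lemma fejer_nonneg: "0 \<le> fejer N n"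
  by (simp add: fejer_def)

lemma uminus_freqs: "n \<in> freqs N \<Longrightarrow> - n \<in> freqs N"
  unfolding freqs_def by force

lemma zero_in_freqs: "0 \<in> freqs N"
proof -
  obtain m where "m \<in> cube N" using cube_nonempty by blast
  then have "(m, m) \<in> cube N \<times> cube N" "0 = (case (m, m) of (m, m') \<Rightarrow> m - m')" by auto
  then show ?thesis unfolding freqs_def by (rule image_eqI[rotated])
qed

lemma fejer_notin_freqs: "n \<notin> freqs N \<Longrightarrow> fejer N n = 0"
proof -
  assume n: "n \<notin> freqs N"
  have "overlap N n = {}"
  proof (rule equals0I)
    fix m assume "m \<in> overlap N n"
    then have "(m + n, m) \<in> cube N \<times> cube N" "n = (m + n) - m" by (auto simp: overlap_def)
    then have "n \<in> freqs N" unfolding freqs_def by (intro image_eqI[of _ _ "(m + n, m)"]) auto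
    with n show False ..
  qed
  then show ?thesis by (simp add: fejer_def)
qed

lemma card_overlap:
  assumes n: "keys n \<subseteq> {..<N}"
  shows "card (overlap N n) = (\<Prod>k<N. nat (int N - \<bar>lookup n k\<bar>))"
proof -
  let ?I = "\<lambda>k. {max 0 (- lookup n k)..<min (int N) (int N - lookup n k)}"
  have "overlap N n = lattice_box N ?I"
  proof (intro equalityI subsetI)
    fix m assume "m \<in> overlap N n"
    then show "m \<in> lattice_box N ?I" by (auto simp: overlap_def lattice_box_def lookup_add)
  next
    fix m assume m: "m \<in> lattice_box N ?I"
    have "keys (m + n) \<subseteq> {..<N}"
      using Poly_Mapping.keys_add[of m n] n m by (auto simp: lattice_box_def)
    then show "m \<in> overlap N n" using m by (auto simp: overlap_def lattice_box_def lookup_add)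
  qed
  then show ?thesis by (simp add: card_lattice_box) (rule prod.cong, auto)
qed

text \<open>For large \<open>N\<close> the coefficient is the finite product of the factors \<open>1 - \<bar>n\<^sub>k\<bar> / N\<close> over the
  support of \<open>n\<close>; all other coordinates contribute the factor 1.\<close>

lemma fejer_tendsto_1: "(\<lambda>N. fejer N n) \<longlonglongrightarrow> 1"
proof -
  obtain K where K: "keys n \<subseteq> {..<K}"
    using finite_nat_iff_bounded[of "keys n"] by auto
  define M where "M = nat (\<Sum>k\<in>keys n. \<bar>lookup n k\<bar>)"
  have M: "\<bar>lookup n k\<bar> \<le> int M" for k
  proof (cases "k \<in> keys n")
    case True
    then have "\<bar>lookup n k\<bar> \<le> (\<Sum>k\<in>keys n. \<bar>lookup n k\<bar>)" by (intro member_le_sum) auto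
    then show ?thesis by (simp add: M_def)
  qed (simp add: in_keys_iff)
  have eq: "fejer N n = (\<Prod>k\<in>keys n. 1 - real_of_int \<bar>lookup n k\<bar> / N)"
    if N: "N \<ge> max (Suc K) M" for N
  proof -
    have "fejer N n = (\<Prod>k<N. (real_of_int (int N - \<bar>lookup n k\<bar>)) / N)"
    proof -
      have "real (\<Prod>k<N. nat (int N - \<bar>lookup n k\<bar>)) = (\<Prod>k<N. real_of_int (int N - \<bar>lookup n k\<bar>))"
        unfolding of_nat_prod
      proof (intro prod.cong refl)
        fix k
        have "int N - \<bar>lookup n k\<bar> \<ge> 0" using M[of k] N by simp
        then show "real (nat (int N - \<bar>lookup n k\<bar>)) = real_of_int (int N - \<bar>lookup n k\<bar>)"
          by (metis int_nat_eq of_int_of_nat_eq)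
      qed
      moreover have "card (overlap N n) = (\<Prod>k<N. nat (int N - \<bar>lookup n k\<bar>))"
        using K N by (intro card_overlap) auto
      ultimately show ?thesis unfolding fejer_def card_cube
        by (simp only: prod_dividef) simp
    qed
    also have "\<dots> = (\<Prod>k<N. 1 - real_of_int \<bar>lookup n k\<bar> / N)"
      using N by (intro prod.cong) (auto simp: field_simps)
    also have "\<dots> = (\<Prod>k\<in>keys n. 1 - real_of_int \<bar>lookup n k\<bar> / N)"
      using K N by (intro prod.mono_neutral_right) (auto simp: in_keys_iff)
    finally show ?thesis .
  qed
  have "(\<lambda>N. \<Prod>k\<in>keys n. 1 - real_of_int \<bar>lookup n k\<bar> / real N) \<longlonglongrightarrow> (\<Prod>k\<in>keys n. 1 - 0)"
    by (intro tendsto_prod tendsto_diff tendsto_const lim_const_over_n)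
  moreover have "eventually (\<lambda>N. (\<Prod>k\<in>keys n. 1 - real_of_int \<bar>lookup n k\<bar> / real N) = fejer N n) sequentially"
    unfolding eventually_sequentially by (intro exI[of _ "max (Suc K) M"] allI impI eq[symmetric])
  ultimately have "(\<lambda>N. fejer N n) \<longlonglongrightarrow> (\<Prod>k\<in>keys n. 1 - 0)"
    by (rule Lim_transform_eventually)
  then show ?thesis by simp
qed

text \<open>The kernel is a normalized squared modulus, hence nonnegative, and as a function of both
  variables it is a finite combination of products of characters. Convolution with it can therefore
  be computed coefficientwise.\<close>

definition fejer_kernel :: "nat \<Rightarrow> (nat \<Rightarrow> complex) \<Rightarrow> (nat \<Rightarrow> complex) \<Rightarrow> real" where
  "fejer_kernel N x y = (cmod (\<Sum>m\<in>cube N. character m x * cnj (character m y)))\<^sup>2 / card (cube N)"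

lemma kernel_nonneg: "0 \<le> fejer_kernel N x y"
  by (simp add: fejer_kernel_def)

lemma kernel_expansion:
  assumes x: "x \<in> space torus_haar" and y: "y \<in> space torus_haar"
  shows "complex_of_real (fejer_kernel N x y) =
    (\<Sum>n\<in>freqs N. complex_of_real (fejer N n) * character n x * cnj (character n y))"
proof -
  let ?c = "complex_of_real (card (cube N))"
  let ?g = "\<lambda>n. character n x * cnj (character n y)"
  have "?c * complex_of_real (fejer_kernel N x y) =
      complex_of_real ((cmod (\<Sum>m\<in>cube N. ?g m))\<^sup>2)"
    by (simp add: fejer_kernel_def)
  also have "\<dots> = (\<Sum>m\<in>cube N. ?g m) * cnj (\<Sum>m\<in>cube N. ?g m)"
    by (simp only: complex_norm_square)
  also have "\<dots> = (\<Sum>(m, m')\<in>cube N \<times> cube N. ?g m * cnj (?g m'))"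
    by (simp only: cnj_sum sum_product sum.cartesian_product)
  also have "\<dots> = (\<Sum>p\<in>cube N \<times> cube N. ?g (fst p - snd p))"
    by (intro sum.cong refl) (auto simp: character_diff x y)
  also have "\<dots> = (\<Sum>n\<in>freqs N. \<Sum>p\<in>{p \<in> cube N \<times> cube N. (case p of (m, m') \<Rightarrow> m - m') = n}. ?g (fst p - snd p))"
    unfolding freqs_def by (rule sum.image_gen) simp
  also have "\<dots> = (\<Sum>n\<in>freqs N. complex_of_real (card (overlap N n)) * ?g n)"
  proof (intro sum.cong refl)
    fix n
    let ?P = "{p \<in> cube N \<times> cube N. (case p of (m, m') \<Rightarrow> m - m') = n}"
    have "(\<Sum>p\<in>?P. ?g (fst p - snd p)) = (\<Sum>p\<in>?P. ?g n)"
      by (intro sum.cong) auto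
    also have "?P = (\<lambda>m. (m + n, m)) ` overlap N n"
      by (auto simp: overlap_def image_iff)
    then have "card ?P = card (overlap N n)"
      by (simp add: card_image inj_on_def)
    then have "(\<Sum>p\<in>?P. ?g n) = complex_of_real (card (overlap N n)) * ?g n" by simp
    finally show "(\<Sum>p\<in>?P. ?g (fst p - snd p)) = complex_of_real (card (overlap N n)) * ?g n" .
  qed
  also have "\<dots> = ?c * (\<Sum>n\<in>freqs N. complex_of_real (fejer N n) * character n x * cnj (character n y))"
    unfolding sum_distrib_left
    by (intro sum.cong refl) (simp add: fejer_def)
  finally show ?thesis by simp
qed

lemma measurable_kernel [measurable]: "fejer_kernel N x \<in> borel_measurable torus_haar"
  unfolding fejer_kernel_def[abs_def] by measurable

definition kernel_bound :: "nat \<Rightarrow> real" where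
  "kernel_bound N = (\<Sum>n\<in>freqs N. fejer N n)"

lemma kernel_le:
  assumes "x \<in> space torus_haar" "y \<in> space torus_haar"
  shows "fejer_kernel N x y \<le> kernel_bound N"
proof -
  have "fejer_kernel N x y = cmod (complex_of_real (fejer_kernel N x y))"
    by (simp add: kernel_nonneg)
  also have "\<dots> \<le> (\<Sum>n\<in>freqs N. cmod (complex_of_real (fejer N n) * character n x * cnj (character n y)))"
    unfolding kernel_expansion[OF assms] by (rule norm_sum)
  also have "\<dots> = kernel_bound N"
    by (simp add: kernel_bound_def norm_mult norm_character assms fejer_nonneg)
  finally show ?thesis .
qed

lemma integrable_kernel_scaleR:
  fixes u :: "(nat \<Rightarrow> complex) \<Rightarrow> 'a :: {banach, second_countable_topology}"
  assumes u: "integrable torus_haar u" and x: "x \<in> space torus_haar"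
  shows "integrable torus_haar (\<lambda>y. fejer_kernel N x y *\<^sub>R u y)"
proof (rule Bochner_Integration.integrable_bound[of _ "\<lambda>y. kernel_bound N *\<^sub>R u y"])
  have [measurable]: "u \<in> borel_measurable torus_haar" using u by simp
  show "(\<lambda>y. fejer_kernel N x y *\<^sub>R u y) \<in> borel_measurable torus_haar" by measurable
  show "AE y in torus_haar. norm (fejer_kernel N x y *\<^sub>R u y) \<le> norm (kernel_bound N *\<^sub>R u y)"
  proof (intro AE_I2)
    fix y assume "y \<in> space torus_haar"
    then have "\<bar>fejer_kernel N x y\<bar> \<le> \<bar>kernel_bound N\<bar>"
      using kernel_le[OF x, of y N] kernel_nonneg[of N x y] by linarith
    then show "norm (fejer_kernel N x y *\<^sub>R u y) \<le> norm (kernel_bound N *\<^sub>R u y)"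
      by (simp add: mult_right_mono)
  qed
qed (simp add: u)

text \<open>The Fejer means of \<open>u\<close>.\<close>

definition smooth ::
    "nat \<Rightarrow> ((nat \<Rightarrow> complex) \<Rightarrow> 'a) \<Rightarrow> (nat \<Rightarrow> complex) \<Rightarrow> 'a::{banach, second_countable_topology}" where
  "smooth N u x = (\<integral>y. fejer_kernel N x y *\<^sub>R u y \<partial>torus_haar)"

lemma smooth_eq_trig:
  assumes u: "integrable torus_haar u" and x: "x \<in> space torus_haar"
  shows "smooth N u x = trig (freqs N) (\<lambda>n. complex_of_real (fejer N n) * fourier u n) x"
proof -
  have "smooth N u x = (\<integral>y. (\<Sum>n\<in>freqs N. complex_of_real (fejer N n) * character n x *
      (u y * cnj (character n y))) \<partial>torus_haar)"
    unfolding smooth_def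
    by (intro Bochner_Integration.integral_cong refl)
       (simp add: scaleR_conv_of_real kernel_expansion[OF x] sum_distrib_left mult_ac)
  also have "\<dots> = (\<Sum>n\<in>freqs N. \<integral>y. complex_of_real (fejer N n) * character n x *
      (u y * cnj (character n y)) \<partial>torus_haar)"
    by (intro Bochner_Integration.integral_sum integrable_mult_right integrable_character_mult u)
  also have "\<dots> = (\<Sum>n\<in>freqs N. complex_of_real (fejer N n) * character n x * fourier u n)"
    by (simp only: integral_mult_right_zero fourier_def)
  also have "\<dots> = trig (freqs N) (\<lambda>n. complex_of_real (fejer N n) * fourier u n) x"
    by (simp add: trig_def mult_ac)
  finally show ?thesis .
qed

lemma smooth_of_real: "complex_of_real (smooth N u x) = smooth N (\<lambda>x. complex_of_real (u x)) x"
  unfolding smooth_def by (simp flip: integral_complex_of_real add: scaleR_conv_of_real)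

lemma fourier_smooth:
  assumes u: "integrable torus_haar u"
  shows "fourier (smooth N u) n = complex_of_real (fejer N n) * fourier u n"
proof -
  have "fourier (smooth N u) n =
      fourier (trig (freqs N) (\<lambda>n. complex_of_real (fejer N n) * fourier u n)) n"
    by (rule fourier_cong) (rule smooth_eq_trig[OF u])
  then show ?thesis by (simp add: fourier_trig fejer_notin_freqs)
qed

lemma measurable_smooth_complex [measurable]:
  assumes "integrable torus_haar (u :: _ \<Rightarrow> complex)"
  shows "smooth N u \<in> borel_measurable torus_haar"
  by (rule measurable_cong[THEN iffD2, OF _ measurable_trig]) (rule smooth_eq_trig[OF assms])

lemma smooth_Re: "smooth N u x = Re (smooth N (\<lambda>x. complex_of_real (u x)) x)"
  by (simp flip: smooth_of_real)

lemma integrable_smooth_complex: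
  assumes "integrable torus_haar (u :: _ \<Rightarrow> complex)"
  shows "integrable torus_haar (smooth N u)"
  by (rule Bochner_Integration.integrable_cong[THEN iffD2, OF refl _ integrable_trig])
     (rule smooth_eq_trig[OF assms])

lemma integrable_smooth:
  assumes "integrable torus_haar (u :: _ \<Rightarrow> real)"
  shows "integrable torus_haar (smooth N u)"
  unfolding smooth_Re[abs_def] using assms
  by (intro integrable_Re integrable_smooth_complex) simp

lemma integral_smooth:
  assumes "integrable torus_haar (u :: _ \<Rightarrow> real)"
  shows "(\<integral>x. smooth N u x \<partial>torus_haar) = (\<integral>x. u x \<partial>torus_haar)"
proof -
  have "complex_of_real (\<integral>x. smooth N u x \<partial>torus_haar) =
      fourier (smooth N (\<lambda>x. complex_of_real (u x))) 0"
    by (simp add: fourier_0 flip: smooth_of_real)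
  also have "\<dots> = complex_of_real (\<integral>x. u x \<partial>torus_haar)"
    using assms by (subst fourier_smooth) (simp_all add: fourier_0)
  finally show ?thesis by (simp only: of_real_eq_iff)
qed

lemma norm_smooth_le: "norm (smooth N u x) \<le> smooth N (\<lambda>x. norm (u x)) x"
  unfolding smooth_def
  by (rule order.trans[OF integral_norm_bound]) (simp add: kernel_nonneg)

text \<open>As the kernel is nonnegative, it suffices to compare with the means of \<open>\<bar>u\<bar>\<close>, whose integral is
  their coefficient at 0.\<close>

lemma smooth_contraction:
  assumes u: "integrable torus_haar (u :: _ \<Rightarrow> complex)"
  shows "(\<integral>x. cmod (smooth N u x) \<partial>torus_haar) \<le> (\<integral>x. cmod (u x) \<partial>torus_haar)"
proof -
  have "(\<integral>x. cmod (smooth N u x) \<partial>torus_haar) \<le> (\<integral>x. smooth N (\<lambda>x. cmod (u x)) x \<partial>torus_haar)"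
    using u by (intro integral_mono norm_smooth_le integrable_norm integrable_smooth
        integrable_smooth_complex) auto
  then show ?thesis using u by (simp add: integral_smooth)
qed

lemma smooth_add:
  assumes "integrable torus_haar u" "integrable torus_haar v" "x \<in> space torus_haar"
  shows "smooth N (\<lambda>x. u x + v x) x = smooth N u x + smooth N v x"
  unfolding smooth_def scaleR_add_right
  by (intro Bochner_Integration.integral_add integrable_kernel_scaleR assms)

lemma smooth_diff:
  assumes "integrable torus_haar u" "integrable torus_haar v" "x \<in> space torus_haar"
  shows "smooth N (\<lambda>x. u x - v x) x = smooth N u x - smooth N v x"
  unfolding smooth_def scaleR_diff_right
  by (intro Bochner_Integration.integral_diff integrable_kernel_scaleR assms)

lemma smooth_const:
  assumes "x \<in> space torus_haar"
  shows "smooth N (\<lambda>_. c::real) x = c"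
proof -
  have c0: "fourier (\<lambda>_. complex_of_real c) n = (if n = 0 then complex_of_real c else 0)" for n
    using fourier_cmult[of "complex_of_real c" "character 0" n] by (simp add: fourier_character)
  have "complex_of_real (smooth N (\<lambda>_. c) x) = (\<Sum>n\<in>freqs N. if n = 0 then complex_of_real c else 0)"
    unfolding smooth_of_real smooth_eq_trig[OF torus.integrable_const assms] trig_def c0
    by (intro sum.cong) auto
  also have "\<dots> = complex_of_real c" by (simp add: zero_in_freqs)
  finally show ?thesis by (simp only: of_real_eq_iff)
qed

lemma smooth_cmult:
  fixes c :: "'a :: {real_normed_field, banach, second_countable_topology}"
  shows "smooth N (\<lambda>x. c * u x) x = c * smooth N u x"
proof -
  have "smooth N (\<lambda>x. c * u x) x = (\<integral>y. c * (fejer_kernel N x y *\<^sub>R u y) \<partial>torus_haar)"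
    unfolding smooth_def by (rule arg_cong[of _ _ "integral\<^sup>L torus_haar"]) auto
  also have "\<dots> = c * smooth N u x" by (simp only: smooth_def integral_mult_right_zero)
  finally show ?thesis .
qed

lemma smooth_mono:
  assumes "integrable torus_haar (u :: _ \<Rightarrow> real)" "integrable torus_haar v" "x \<in> space torus_haar"
    and "\<And>y. y \<in> space torus_haar \<Longrightarrow> u y \<le> v y"
  shows "smooth N u x \<le> smooth N v x"
  unfolding smooth_def
proof (rule integral_mono)
  show "fejer_kernel N x y *\<^sub>R u y \<le> fejer_kernel N x y *\<^sub>R v y" if "y \<in> space torus_haar" for y
    using assms(4)[OF that] kernel_nonneg[of N x y] by (simp add: mult_left_mono)
qed (intro integrable_kernel_scaleR assms)+

text \<open>Jensen's inequality for the probability density \<open>fejer_kernel N x\<close>.\<close>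

lemma exp_smooth_le:
  fixes u :: "(nat \<Rightarrow> complex) \<Rightarrow> real"
  assumes u: "integrable torus_haar u" and eu: "integrable torus_haar (\<lambda>y. exp (u y))"
    and x: "x \<in> space torus_haar"
  shows "exp (smooth N u x) \<le> smooth N (\<lambda>y. exp (u y)) x"
proof -
  define c where "c = smooth N u x"
  have lin: "integrable torus_haar (\<lambda>y. exp c * (1 + (u y - c)))" using u by simp
  \<comment> \<open>The tangent to the exponential at the mean \<open>c\<close>.\<close>
  have "exp c * (1 + (u y - c)) \<le> exp (u y)" for y
    using exp_ge_add_one_self[of "u y - c"] by (simp add: exp_diff field_simps)
  then have "smooth N (\<lambda>y. exp c * (1 + (u y - c))) x \<le> smooth N (\<lambda>y. exp (u y)) x"
    by (intro smooth_mono lin eu x)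
  also have "smooth N (\<lambda>y. exp c * (1 + (u y - c))) x =
      smooth N (\<lambda>y. exp c * u y) x + smooth N (\<lambda>y. exp c * (1 - c)) x"
    using u x by (subst smooth_add[symmetric]) (simp_all add: algebra_simps)
  also have "smooth N (\<lambda>y. exp c * (1 - c)) x = exp c * (1 - c)" by (rule smooth_const[OF x])
  also have "smooth N (\<lambda>y. exp c * u y) x = exp c * smooth N u x" by (rule smooth_cmult)
  finally show ?thesis by (simp add: c_def algebra_simps)
qed

text \<open>Characters are eigenfunctions of \<open>smooth N\<close>, with eigenvalues tending to 1.\<close>

lemma smooth_trig_poly_tendsto:
  "trig_poly p \<Longrightarrow> (\<lambda>N. \<integral>x. cmod (smooth N p x - p x) \<partial>torus_haar) \<longlonglongrightarrow> 0"
proof (induction rule: trig_poly.induct)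
  case (character n)
  have eq: "smooth N (character n) x = complex_of_real (fejer N n) * character n x"
    if x: "x \<in> space torus_haar" for N x
  proof -
    have "smooth N (character n) x =
        (\<Sum>m\<in>freqs N. if n = m then complex_of_real (fejer N m) * character m x else 0)"
      unfolding smooth_eq_trig[OF integrable_character x] trig_def
      by (intro sum.cong refl) (auto simp: fourier_character)
    also have "\<dots> = complex_of_real (fejer N n) * character n x"
      by (auto simp: fejer_notin_freqs)
    finally show ?thesis .
  qed
  have "(\<integral>x. cmod (smooth N (character n) x - character n x) \<partial>torus_haar) = \<bar>fejer N n - 1\<bar>" for N
  proof -
    have "(\<integral>x. cmod (smooth N (character n) x - character n x) \<partial>torus_haar) =
        (\<integral>x. \<bar>fejer N n - 1\<bar> \<partial>torus_haar)"
    proof (intro Bochner_Integration.integral_cong refl)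
      fix x assume x: "x \<in> space torus_haar"
      have "smooth N (character n) x - character n x =
          complex_of_real (fejer N n - 1) * character n x"
        by (simp add: eq[OF x] algebra_simps)
      then show "cmod (smooth N (character n) x - character n x) = \<bar>fejer N n - 1\<bar>"
        by (simp only: norm_mult norm_of_real norm_character[OF x] mult_1_right)
    qed
    then show ?thesis by (simp add: torus.prob_space)
  qed
  moreover have "(\<lambda>N. \<bar>fejer N n - 1\<bar>) \<longlonglongrightarrow> 0"
    using fejer_tendsto_1[of n] by (auto intro!: tendsto_eq_intros)
  ultimately show ?case by simp
next
  case (scale f c)
  have "smooth N (\<lambda>x. c * f x) x - c * f x = c * (smooth N f x - f x)" for N x
    by (simp add: smooth_cmult right_diff_distrib)
  then have "cmod (smooth N (\<lambda>x. c * f x) x - c * f x) = cmod c * cmod (smooth N f x - f x)" for N x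
    by (simp only: norm_mult)
  then have "(\<integral>x. cmod (smooth N (\<lambda>x. c * f x) x - c * f x) \<partial>torus_haar) =
      cmod c * (\<integral>x. cmod (smooth N f x - f x) \<partial>torus_haar)" for N
    by (simp only: integral_mult_right_zero)
  with tendsto_mult_left[OF scale.IH, of "cmod c"] show ?case by simp
next
  case (add f g)
  have [simp]: "integrable torus_haar f" "integrable torus_haar g"
    using add.hyps integrable_trig_poly by auto
  have [simp]: "integrable torus_haar (smooth N f)" "integrable torus_haar (smooth N g)"
    "integrable torus_haar (smooth N (\<lambda>x. f x + g x))" for N
    by (auto intro: integrable_smooth_complex)
  have le: "(\<integral>x. cmod (smooth N (\<lambda>x. f x + g x) x - (f x + g x)) \<partial>torus_haar) \<le>
      (\<integral>x. cmod (smooth N f x - f x) \<partial>torus_haar) + (\<integral>x. cmod (smooth N g x - g x) \<partial>torus_haar)" for N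
  proof -
    have "(\<integral>x. cmod (smooth N (\<lambda>x. f x + g x) x - (f x + g x)) \<partial>torus_haar) \<le>
      (\<integral>x. cmod (smooth N f x - f x) + cmod (smooth N g x - g x) \<partial>torus_haar)"
      by (intro integral_mono) (auto simp: smooth_add intro: norm_diff_triangle_ineq)
    then show ?thesis by simp
  qed
  show ?case
  proof (rule tendsto_sandwich[OF _ _ tendsto_const])
    show "(\<lambda>N. (\<integral>x. cmod (smooth N f x - f x) \<partial>torus_haar) +
        (\<integral>x. cmod (smooth N g x - g x) \<partial>torus_haar)) \<longlonglongrightarrow> 0"
      using tendsto_add[OF add.IH] by simp
  qed (use le in auto)
next
  case (cong f g)
  have "smooth N g x = smooth N f x" for N x
    unfolding smooth_def
    by (intro Bochner_Integration.integral_cong refl) (simp add: cong.hyps)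
  then have "(\<integral>x. cmod (smooth N g x - g x) \<partial>torus_haar) =
      (\<integral>x. cmod (smooth N f x - f x) \<partial>torus_haar)" for N
    by (intro Bochner_Integration.integral_cong refl) (simp add: cong.hyps)
  then show ?case using cong.IH by simp
qed

theorem smooth_tendsto_complex:
  assumes f: "integrable torus_haar f"
  shows "(\<lambda>N. \<integral>x. cmod (smooth N f x - f x) \<partial>torus_haar) \<longlonglongrightarrow> 0"
proof (rule LIMSEQ_I)
  fix e :: real assume e: "e > 0"
  obtain p where p: "trig_poly p" "(\<integral>x. cmod (f x - p x) \<partial>torus_haar) < e / 3"
    using approximable_integrable[OF f, unfolded approximable_def, THEN conjunct2, rule_format, of "e / 3"] e
    by auto
  have pi: "integrable torus_haar p" by (rule integrable_trig_poly[OF p(1)])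
  obtain M where M: "\<And>N. N \<ge> M \<Longrightarrow> norm ((\<integral>x. cmod (smooth N p x - p x) \<partial>torus_haar) - 0) < e / 3"
    using LIMSEQ_D[OF smooth_trig_poly_tendsto[OF p(1)], of "e / 3"] e by auto
  show "\<exists>M. \<forall>N\<ge>M. norm ((\<integral>x. cmod (smooth N f x - f x) \<partial>torus_haar) - 0) < e"
  proof (intro exI allI impI)
    fix N assume "N \<ge> M"
    note sm = integrable_smooth_complex[OF f, of N] integrable_smooth_complex[OF pi, of N]
    have "(\<integral>x. cmod (smooth N f x - smooth N p x) \<partial>torus_haar) =
        (\<integral>x. cmod (smooth N (\<lambda>x. f x - p x) x) \<partial>torus_haar)"
      by (intro Bochner_Integration.integral_cong refl) (simp add: smooth_diff f pi)
    also have "\<dots> \<le> (\<integral>x. cmod (f x - p x) \<partial>torus_haar)"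
      using f pi by (intro smooth_contraction) auto
    finally have "(\<integral>x. cmod (smooth N f x - smooth N p x) \<partial>torus_haar) < e / 3" using p by simp
    moreover have "(\<integral>x. cmod (smooth N p x - p x) \<partial>torus_haar) < e / 3"
      using M[OF \<open>N \<ge> M\<close>] by simp
    moreover have "(\<integral>x. cmod (p x - f x) \<partial>torus_haar) < e / 3"
      using p(2) by (simp add: norm_minus_commute)
    ultimately have "(\<integral>x. cmod (smooth N f x - f x) \<partial>torus_haar) < e"
      using L1_triangle[OF sm(1) sm(2) f] L1_triangle[OF sm(2) pi f] by linarith
    then show "norm ((\<integral>x. cmod (smooth N f x - f x) \<partial>torus_haar) - 0) < e" by simp
  qed
qed

theorem smooth_tendsto:
  assumes u: "integrable torus_haar (u :: _ \<Rightarrow> real)"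
  shows "(\<lambda>N. \<integral>x. \<bar>smooth N u x - u x\<bar> \<partial>torus_haar) \<longlonglongrightarrow> 0"
proof -
  have "cmod (smooth N (\<lambda>x. complex_of_real (u x)) x - complex_of_real (u x)) = \<bar>smooth N u x - u x\<bar>" for N x
    unfolding smooth_of_real[symmetric] of_real_diff[symmetric] norm_of_real ..
  then show ?thesis
    using smooth_tendsto_complex[of "\<lambda>x. complex_of_real (u x)"] u by simp
qed

lemma smooth_AE_subsequence:
  assumes u: "integrable torus_haar (u :: _ \<Rightarrow> real)"
  obtains r where "strict_mono r" "AE x in torus_haar. (\<lambda>i. smooth (r i) u x) \<longlonglongrightarrow> u x"
proof -
  have "\<exists>r::nat \<Rightarrow> nat. strict_mono r \<and> (AE x in torus_haar. (\<lambda>i. smooth (r i) u x - u x) \<longlonglongrightarrow> 0)"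
  proof (rule tendsto_L1_AE_subseq)
    show "(\<lambda>N. \<integral>x. norm (smooth N u x - u x) \<partial>torus_haar) \<longlonglongrightarrow> 0"
      unfolding real_norm_def by (rule smooth_tendsto[OF u])
  qed (intro Bochner_Integration.integrable_diff integrable_smooth u)
  then obtain r where r: "strict_mono (r :: nat \<Rightarrow> nat)"
      "AE x in torus_haar. (\<lambda>i. smooth (r i) u x - u x) \<longlonglongrightarrow> 0" by blast
  have "AE x in torus_haar. (\<lambda>i. smooth (r i) u x) \<longlonglongrightarrow> u x"
    using r(2) by (simp only: LIM_zero_iff)
  with r(1) show ?thesis by (rule that)
qed

section \<open>Spectra of exponentials\<close>

definition spectrum_in :: "(nat \<Rightarrow>\<^sub>0 int) set \<Rightarrow> ((nat \<Rightarrow> complex) \<Rightarrow> complex) \<Rightarrow> bool" where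
  "spectrum_in S f \<longleftrightarrow> integrable torus_haar f \<and> (\<forall>n. n \<notin> S \<longrightarrow> fourier f n = 0)"

lemma spectrum_in_add:
  "spectrum_in S f \<Longrightarrow> spectrum_in S g \<Longrightarrow> spectrum_in S (\<lambda>x. f x + g x)"
  by (simp add: spectrum_in_def fourier_add)

lemma spectrum_in_const: "0 \<in> S \<Longrightarrow> spectrum_in S (\<lambda>_. c)"
  using fourier_cmult[of c "character 0"] by (auto simp: spectrum_in_def fourier_character)

text \<open>Multiplication by the character of \<open>m\<close> translates the Fourier coefficients by \<open>m\<close>.\<close>

lemma spectrum_in_mult_trig:
  assumes f: "spectrum_in S f" and A: "finite A" "\<And>m. m \<in> A \<Longrightarrow> c m \<noteq> 0 \<Longrightarrow> m \<in> T"
    and ST: "\<And>s t. s \<in> S \<Longrightarrow> t \<in> T \<Longrightarrow> s + t \<in> S'"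
  shows "spectrum_in S' (\<lambda>x. f x * trig A c x)"
proof -
  have fi: "integrable torus_haar f" using f by (simp add: spectrum_in_def)
  have int: "integrable torus_haar (\<lambda>x. c m * (f x * character m x))" for m
    by (intro integrable_mult_right integrable_character_mult fi)
  have eq: "f x * trig A c x = (\<Sum>m\<in>A. c m * (f x * character m x))" for x
    by (simp add: trig_def sum_distrib_left mult_ac)
  show ?thesis
    unfolding spectrum_in_def eq
  proof (intro conjI allI impI)
    fix n assume n: "n \<notin> S'"
    have "fourier (\<lambda>x. \<Sum>m\<in>A. c m * (f x * character m x)) n = (\<Sum>m\<in>A. c m * fourier f (n - m))"
      using int by (subst fourier_sum) (simp_all add: fourier_cmult fourier_mult_character)
    also have "\<dots> = 0"
    proof (intro sum.neutral ballI)
      fix m assume m: "m \<in> A"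
      show "c m * fourier f (n - m) = 0"
      proof (cases "c m = 0")
        case False
        have "n - m \<notin> S"
          using ST[of "n - m" m] A(2)[OF m False] n by auto
        then show ?thesis using f by (simp add: spectrum_in_def)
      qed simp
    qed
    finally show "fourier (\<lambda>x. \<Sum>m\<in>A. c m * (f x * character m x)) n = 0" .
  qed (intro Bochner_Integration.integrable_sum int)
qed

lemma sums_exp_minus_1: "(\<lambda>k. z ^ Suc k /\<^sub>R fact (Suc k)) sums (exp z - 1)" for z :: complex
  using sums_split_initial_segment[OF exp_converges[of z], of 1] by simp

text \<open>The exponential series turns statements on products with trigonometric polynomials into
  statements on their exponentials. Subtracting 1 removes the only term of the series whose
  spectrum is not moved by \<open>T\<close>.\<close>

lemma spectrum_in_mult_exp_minus_1:
  assumes f: "spectrum_in S f" and A: "finite A" "\<And>m. m \<in> A \<Longrightarrow> c m \<noteq> 0 \<Longrightarrow> m \<in> T"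
    and ST: "\<And>s t. s \<in> S \<Longrightarrow> t \<in> T \<Longrightarrow> s + t \<in> S'"
    and S'T: "\<And>s t. s \<in> S' \<Longrightarrow> t \<in> T \<Longrightarrow> s + t \<in> S'"
  shows "spectrum_in S' (\<lambda>x. f x * (exp (trig A c x) - 1))"
proof -
  let ?D = "trig A c"
  define B where "B = (\<Sum>n\<in>A. cmod (c n))"
  have fi: "integrable torus_haar f" using f by (simp add: spectrum_in_def)
  then have [measurable]: "f \<in> borel_measurable torus_haar" by simp
  have pow: "spectrum_in S' (\<lambda>x. f x * ?D x ^ Suc k)" for k
  proof (induction k)
    case 0
    then show ?case using spectrum_in_mult_trig[OF f A ST] by simp
  next
    case (Suc k)
    have "spectrum_in S' (\<lambda>x. f x * ?D x ^ Suc k * ?D x)"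
      by (rule spectrum_in_mult_trig[OF Suc A S'T])
    then show ?case by (simp add: mult_ac)
  qed
  have DB: "cmod (?D x) \<le> B" if "x \<in> space torus_haar" for x
    using norm_trig_le[OF that] by (simp add: B_def)
  have fB: "integrable torus_haar (\<lambda>x. exp B * cmod (f x))" using fi by simp
  have bound: "cmod (f x * (\<Sum>k<i. ?D x ^ Suc k /\<^sub>R fact (Suc k))) \<le> exp B * cmod (f x)"
    if x: "x \<in> space torus_haar" for x i
  proof -
    have "cmod (\<Sum>k<i. ?D x ^ Suc k /\<^sub>R fact (Suc k)) \<le> (\<Sum>k<i. cmod (?D x) ^ Suc k /\<^sub>R fact (Suc k))"
      by (rule order.trans[OF norm_sum]) (simp add: norm_mult norm_power)
    also have "\<dots> = (\<Sum>k\<in>{1..<Suc i}. cmod (?D x) ^ k /\<^sub>R fact k)"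
      by (rule sum.reindex_bij_witness[of _ "\<lambda>k. k - 1" Suc]) auto
    also have "\<dots> \<le> suminf (\<lambda>k. cmod (?D x) ^ k /\<^sub>R fact k)"
      by (intro sum_le_suminf summable_exp_generic) auto
    also have "\<dots> = exp (cmod (?D x))" by (simp add: exp_def)
    also have "\<dots> \<le> exp B" using DB[OF x] by simp
    finally have "cmod (f x) * cmod (\<Sum>k<i. ?D x ^ Suc k /\<^sub>R fact (Suc k)) \<le> cmod (f x) * exp B"
      by (rule mult_left_mono) simp
    then show ?thesis by (simp only: norm_mult mult.commute)
  qed
  have lim: "(\<lambda>i. f x * (\<Sum>k<i. ?D x ^ Suc k /\<^sub>R fact (Suc k))) \<longlonglongrightarrow> f x * (exp (?D x) - 1)" for x
    using sums_exp_minus_1[of "?D x"] unfolding sums_def by (rule tendsto_mult_left)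
  have int: "integrable torus_haar (\<lambda>x. f x * (exp (?D x) - 1))"
    by (rule integrable_dominated_convergence[where s = "\<lambda>i x. f x * (\<Sum>k<i. ?D x ^ Suc k /\<^sub>R fact (Suc k))"
          and w = "\<lambda>x. exp B * cmod (f x)"])
       (use bound lim fB in \<open>auto simp del: power_Suc fact_Suc\<close>)
  have "fourier (\<lambda>x. f x * (exp (?D x) - 1)) n = 0" if n: "n \<notin> S'" for n
  proof -
    have zero: "fourier (\<lambda>x. f x * (\<Sum>k<i. ?D x ^ Suc k /\<^sub>R fact (Suc k))) n = 0" for i
    proof -
      have "fourier (\<lambda>x. \<Sum>k<i. of_real (inverse (fact (Suc k))) * (f x * ?D x ^ Suc k)) n =
          (\<Sum>k<i. of_real (inverse (fact (Suc k))) * fourier (\<lambda>x. f x * ?D x ^ Suc k) n)"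
        using pow by (subst fourier_sum)
          (auto simp: fourier_cmult spectrum_in_def simp del: power_Suc fact_Suc)
      also have "\<dots> = 0" using pow n by (simp add: spectrum_in_def del: power_Suc fact_Suc)
      finally show ?thesis
        by (simp add: sum_distrib_left scaleR_conv_of_real mult_ac del: power_Suc fact_Suc)
    qed
    have "(\<lambda>i. fourier (\<lambda>x. f x * (\<Sum>k<i. ?D x ^ Suc k /\<^sub>R fact (Suc k))) n)
        \<longlonglongrightarrow> fourier (\<lambda>x. f x * (exp (?D x) - 1)) n"
      unfolding fourier_def
    proof (rule integral_dominated_convergence[where w = "\<lambda>x. exp B * cmod (f x)"])
      show "AE x in torus_haar. (\<lambda>i. f x * (\<Sum>k<i. ?D x ^ Suc k /\<^sub>R fact (Suc k)) * cnj (character n x))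
          \<longlonglongrightarrow> f x * (exp (?D x) - 1) * cnj (character n x)"
        by (intro AE_I2 tendsto_mult_right lim)
      show "AE x in torus_haar. norm (f x * (\<Sum>k<i. ?D x ^ Suc k /\<^sub>R fact (Suc k)) * cnj (character n x))
          \<le> exp B * cmod (f x)" for i
        using bound by (intro AE_I2) (simp add: norm_mult norm_character del: power_Suc fact_Suc)
    qed (use fB in auto)
    then show ?thesis unfolding zero by (simp add: LIMSEQ_const_iff)
  qed
  with int show ?thesis by (simp add: spectrum_in_def)
qed

lemma spectrum_in_mult_exp:
  assumes f: "spectrum_in S f" and A: "finite A" "\<And>m. m \<in> A \<Longrightarrow> c m \<noteq> 0 \<Longrightarrow> m \<in> T"
    and ST: "\<And>s t. s \<in> S \<Longrightarrow> t \<in> T \<Longrightarrow> s + t \<in> S"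
  shows "spectrum_in S (\<lambda>x. f x * exp (trig A c x))"
proof -
  have "(\<lambda>x. f x * exp (trig A c x)) = (\<lambda>x. f x * (exp (trig A c x) - 1) + f x)"
    by (simp add: algebra_simps)
  then show ?thesis
    using spectrum_in_add[OF spectrum_in_mult_exp_minus_1[OF f A ST ST] f] by simp
qed

text \<open>For symmetric coefficients, conjugation maps the part with frequencies in \<open>P\<close> to the part with
  frequencies in \<open>- P\<close>.\<close>

lemma cnj_trig_symmetric:
  assumes F: "\<And>n. n \<in> F \<Longrightarrow> - n \<in> F" and c: "\<And>n. c (- n) = cnj (c n)"
    and x: "x \<in> space torus_haar"
  shows "cnj (trig {n \<in> F. P n} c x) = trig {n \<in> F. P (- n)} c x"
proof -
  have "cnj (trig {n \<in> F. P n} c x) = (\<Sum>n\<in>{n \<in> F. P n}. c (- n) * character (- n) x)"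
    by (simp add: trig_def c character_uminus[OF x])
  also have "\<dots> = trig {n \<in> F. P (- n)} c x"
    unfolding trig_def
    by (rule sum.reindex_bij_witness[of _ uminus uminus]) (use F in auto)
  finally show ?thesis .
qed

text \<open>The degrees that play the role of the exponent in one complex variable. Geometrically, \<open>d\<close>
  is dual to a one-parameter subgroup of the torus, along which functions with spectrum in \<open>Z_plus\<close>
  are boundary values of holomorphic functions on the unit disc.\<close>

locale positive_grading =
  fixes d :: "(nat \<Rightarrow>\<^sub>0 int) \<Rightarrow> int"
  assumes d_add: "d (m + n) = d m + d n"
    and d_pos: "n \<in> Z_plus \<Longrightarrow> n \<noteq> 0 \<Longrightarrow> 0 < d n"
begin

lemma d_0 [simp]: "d 0 = 0"
  using d_add[of 0 0] by simp

lemma d_uminus [simp]: "d (- n) = - d n"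
  using d_add[of n "- n"] by simp

text \<open>The Fourier coefficients of \<open>smooth N u\<close>.\<close>

definition smooth_coeff :: "nat \<Rightarrow> ((nat \<Rightarrow> complex) \<Rightarrow> real) \<Rightarrow> (nat \<Rightarrow>\<^sub>0 int) \<Rightarrow> complex" where
  "smooth_coeff N u n = complex_of_real (fejer N n) * fourier (\<lambda>x. complex_of_real (u x)) n"

text \<open>The part of degree 0 of \<open>smooth N u\<close>. It is real-valued, so taking the real part changes nothing
  and merely fixes the type.\<close>

definition level_part :: "nat \<Rightarrow> ((nat \<Rightarrow> complex) \<Rightarrow> real) \<Rightarrow> (nat \<Rightarrow> complex) \<Rightarrow> real" where
  "level_part N u x = Re (trig {n \<in> freqs N. d n = 0} (smooth_coeff N u) x)"

definition positive_part :: "nat \<Rightarrow> ((nat \<Rightarrow> complex) \<Rightarrow> real) \<Rightarrow> (nat \<Rightarrow> complex) \<Rightarrow> complex" where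
  "positive_part N u = trig {n \<in> freqs N. 0 < d n} (smooth_coeff N u)"

lemma smooth_coeff_uminus: "smooth_coeff N u (- n) = cnj (smooth_coeff N u n)"
  by (simp add: smooth_coeff_def fejer_uminus fourier_of_real_uminus)

lemma cnj_trig_smooth_coeff:
  assumes "x \<in> space torus_haar"
  shows "cnj (trig {n \<in> freqs N. P n} (smooth_coeff N u) x) =
    trig {n \<in> freqs N. P (- n)} (smooth_coeff N u) x"
  by (rule cnj_trig_symmetric[where F = "freqs N"]) (auto simp: assms uminus_freqs smooth_coeff_uminus)

lemma level_part_eq:
  assumes x: "x \<in> space torus_haar"
  shows "complex_of_real (level_part N u x) = trig {n \<in> freqs N. d n = 0} (smooth_coeff N u) x"
proof -
  have "cnj (trig {n \<in> freqs N. d n = 0} (smooth_coeff N u) x) =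
      trig {n \<in> freqs N. d n = 0} (smooth_coeff N u) x"
    using cnj_trig_smooth_coeff[OF x, of N "\<lambda>n. d n = 0" u] by simp
  then show ?thesis by (simp add: level_part_def complex_eq_iff)
qed

lemma smooth_decomposition:
  assumes u: "integrable torus_haar u" and x: "x \<in> space torus_haar"
  shows "smooth N u x = level_part N u x + 2 * Re (positive_part N u x)"
proof -
  let ?t = "\<lambda>P. trig {n \<in> freqs N. P n} (smooth_coeff N u) x"
  have "complex_of_real (smooth N u x) = trig (freqs N) (smooth_coeff N u) x"
    unfolding smooth_of_real smooth_coeff_def using u by (intro smooth_eq_trig x) simp
  also have "\<dots> = ?t (\<lambda>n. d n = 0) + ?t (\<lambda>n. 0 < d n) + ?t (\<lambda>n. d n < 0)"
  proof -
    have "freqs N = {n \<in> freqs N. d n = 0} \<union> {n \<in> freqs N. 0 < d n} \<union> {n \<in> freqs N. d n < 0}"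
      by auto
    then show ?thesis
      unfolding trig_def by (subst sum.union_disjoint[symmetric], auto)+
  qed
  also have "?t (\<lambda>n. d n < 0) = cnj (positive_part N u x)"
    unfolding positive_part_def
    using cnj_trig_smooth_coeff[OF x, of N "\<lambda>n. 0 < d n" u] by simp
  also have "?t (\<lambda>n. d n = 0) = complex_of_real (level_part N u x)"
    by (rule level_part_eq[OF x, symmetric])
  finally have "Re (complex_of_real (smooth N u x)) =
      Re (complex_of_real (level_part N u x) + positive_part N u x + cnj (positive_part N u x))"
    by (simp only: positive_part_def)
  then show ?thesis by simp
qed

lemma measurable_level_part [measurable]: "level_part N u \<in> borel_measurable torus_haar"
  unfolding level_part_def[abs_def] by measurable

lemma integrable_level_part [simp]: "integrable torus_haar (level_part N u)"
  unfolding level_part_def[abs_def] by (intro integrable_Re integrable_trig)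

lemma fourier_level_part:
  assumes "d n = 0"
  shows "fourier (\<lambda>x. complex_of_real (level_part N u x)) n = smooth_coeff N u n"
proof -
  have "fourier (\<lambda>x. complex_of_real (level_part N u x)) n =
      fourier (trig {n \<in> freqs N. d n = 0} (smooth_coeff N u)) n"
    by (rule fourier_cong) (rule level_part_eq)
  also have "\<dots> = smooth_coeff N u n"
    using assms by (subst fourier_trig) (auto simp: smooth_coeff_def fejer_notin_freqs)
  finally show ?thesis .
qed

lemma integral_level_part: "(\<integral>x. level_part N u x \<partial>torus_haar) = (\<integral>x. u x \<partial>torus_haar)"
proof -
  have "complex_of_real (\<integral>x. level_part N u x \<partial>torus_haar) = complex_of_real (\<integral>x. u x \<partial>torus_haar)"
    using fourier_level_part[of 0 N u] by (simp add: fourier_0 smooth_coeff_def)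
  then show ?thesis by (simp only: of_real_eq_iff)
qed

text \<open>The analogue of the Herglotz transform: no negative degrees, and real part half of
  \<open>smooth N u\<close>.\<close>

definition half_trig :: "nat \<Rightarrow> ((nat \<Rightarrow> complex) \<Rightarrow> real) \<Rightarrow> (nat \<Rightarrow> complex) \<Rightarrow> complex" where
  "half_trig N u x = complex_of_real (level_part N u x) / 2 + positive_part N u x"

lemma Re_half_trig:
  assumes "integrable torus_haar u" "x \<in> space torus_haar"
  shows "Re (half_trig N u x) = smooth N u x / 2"
  using smooth_decomposition[OF assms] by (simp add: half_trig_def)

lemma measurable_half_trig [measurable]: "half_trig N u \<in> borel_measurable torus_haar"
  unfolding half_trig_def[abs_def] positive_part_def by measurable

lemma trig_scale: "a * trig A c x = trig A (\<lambda>n. a * c n) x"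
  by (simp add: trig_def sum_distrib_left mult.assoc)

lemma half_trig_eq_trig:
  assumes x: "x \<in> space torus_haar"
  shows "half_trig N u x =
    trig {n \<in> freqs N. 0 \<le> d n} (\<lambda>n. (if d n = 0 then 1 / 2 else 1) * smooth_coeff N u n) x"
proof -
  let ?c = "\<lambda>n. (if d n = 0 then 1 / 2 else 1) * smooth_coeff N u n"
  have "complex_of_real (level_part N u x) / 2 = trig {n \<in> freqs N. d n = 0} ?c x"
    unfolding level_part_eq[OF x] by (simp add: trig_def sum_divide_distrib)
  moreover have "positive_part N u x = trig {n \<in> freqs N. 0 < d n} ?c x"
    unfolding positive_part_def trig_def by (intro sum.cong) auto
  moreover have "trig {n \<in> freqs N. 0 \<le> d n} ?c x =
      trig {n \<in> freqs N. d n = 0} ?c x + trig {n \<in> freqs N. 0 < d n} ?c x"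
  proof -
    have "{n \<in> freqs N. 0 \<le> d n} = {n \<in> freqs N. d n = 0} \<union> {n \<in> freqs N. 0 < d n}" by auto
    then show ?thesis unfolding trig_def by (simp only:) (rule sum.union_disjoint, auto)
  qed
  ultimately show ?thesis by (simp add: half_trig_def)
qed

lemma spectrum_in_cong:
  assumes "spectrum_in S f" "\<And>x. x \<in> space torus_haar \<Longrightarrow> g x = f x"
  shows "spectrum_in S g"
  using assms Bochner_Integration.integrable_cong[of torus_haar torus_haar g f] fourier_cong[of g f]
  unfolding spectrum_in_def by auto

text \<open>Multiplication by \<open>exp (- half_trig N u)\<close> only raises degrees, and among the frequencies of
  \<open>f\<close> only 0 has degree 0. So in degree 0 the product is the constant \<open>fourier f 0\<close> times the
  degree 0 part of the exponential.\<close>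

lemma integral_mult_exp_half_trig:
  assumes f: "spectrum_in Z_plus f"
  shows "(\<integral>x. f x * exp (- half_trig N u x) \<partial>torus_haar) =
    fourier f 0 * complex_of_real (\<integral>x. exp (- level_part N u x / 2) \<partial>torus_haar)"
    and "integrable torus_haar (\<lambda>x. f x * exp (- half_trig N u x))"
proof -
  let ?D = "\<lambda>x. - half_trig N u x" and ?Z = "\<lambda>x. complex_of_real (- level_part N u x / 2)"
  let ?H = "\<lambda>x. - positive_part N u x" and ?b = "fourier f 0"
  have Z_trig: "?Z x = trig {n \<in> freqs N. d n = 0} (\<lambda>n. (- 1 / 2) * smooth_coeff N u n) x"
    if "x \<in> space torus_haar" for x
    by (simp only: trig_scale[symmetric] level_part_eq[OF that, symmetric]) simp
  have H_trig: "?H x = trig {n \<in> freqs N. 0 < d n} (\<lambda>n. (- 1) * smooth_coeff N u n) x" for x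
    by (simp only: trig_scale[symmetric] positive_part_def) simp
  have D_trig: "?D x = trig {n \<in> freqs N. 0 \<le> d n}
      (\<lambda>n. (- 1) * ((if d n = 0 then 1 / 2 else 1) * smooth_coeff N u n)) x"
    if "x \<in> space torus_haar" for x
    by (simp only: trig_scale[symmetric] half_trig_eq_trig[OF that]) simp
  have f0: "spectrum_in {n. 0 < d n} (\<lambda>x. f x - ?b)"
    unfolding spectrum_in_def
  proof (intro conjI allI impI)
    have fi: "integrable torus_haar f" using f by (simp add: spectrum_in_def)
    then show "integrable torus_haar (\<lambda>x. f x - ?b)" by simp
    fix n assume n: "n \<notin> {n. 0 < d n}"
    have const: "fourier (\<lambda>_. ?b) n = (if n = 0 then ?b else 0)"
      using fourier_cmult[of ?b "character 0" n] by (simp add: fourier_character)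
    have "fourier (\<lambda>x. f x - ?b) n = fourier f n - fourier (\<lambda>_. ?b) n"
      using fi by (intro fourier_diff) auto
    also have "\<dots> = 0"
      using n d_pos[of n] f by (auto simp: const spectrum_in_def)
    finally show "fourier (\<lambda>x. f x - ?b) n = 0" .
  qed
  have "spectrum_in {n. 0 < d n} (\<lambda>x. (f x - ?b) * exp (trig {n \<in> freqs N. 0 \<le> d n}
      (\<lambda>n. (- 1) * ((if d n = 0 then 1 / 2 else 1) * smooth_coeff N u n)) x))"
    by (rule spectrum_in_mult_exp[OF f0, where T = "{n. 0 \<le> d n}"]) (auto simp: d_add)
  then have 1: "spectrum_in {n. 0 < d n} (\<lambda>x. (f x - ?b) * exp (?D x))"
    by (rule spectrum_in_cong) (simp only: D_trig)
  have "spectrum_in {n. d n = 0} (\<lambda>x. 1 * exp (trig {n \<in> freqs N. d n = 0} (\<lambda>n. (- 1 / 2) * smooth_coeff N u n) x))"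
    by (rule spectrum_in_mult_exp[where T = "{n. d n = 0}"]) (auto simp: d_add spectrum_in_const)
  then have 2: "spectrum_in {n. d n = 0} (\<lambda>x. exp (?Z x))"
    by (rule spectrum_in_cong) (simp only: Z_trig mult_1)
  have "spectrum_in {n. 0 < d n} (\<lambda>x. exp (?Z x) * (exp (trig {n \<in> freqs N. 0 < d n}
      (\<lambda>n. (- 1) * smooth_coeff N u n) x) - 1))"
    by (rule spectrum_in_mult_exp_minus_1[OF 2, where T = "{n. 0 < d n}"]) (auto simp: d_add)
  then have 3: "spectrum_in {n. 0 < d n} (\<lambda>x. exp (?Z x) * (exp (?H x) - 1))"
    by (simp only: H_trig)
  \<comment> \<open>The first two summands have positive degrees only, hence integral 0.\<close>
  have split: "f x * exp (?D x) = (f x - ?b) * exp (?D x) + ?b * (exp (?Z x) * (exp (?H x) - 1)) + ?b * exp (?Z x)" for x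
  proof -
    have "exp (?D x) = exp (?Z x) * exp (?H x)"
      by (simp add: half_trig_def flip: exp_add)
    then show ?thesis by (simp only:) (simp add: algebra_simps)
  qed
  have int: "integrable torus_haar (\<lambda>x. (f x - ?b) * exp (?D x))"
    "integrable torus_haar (\<lambda>x. exp (?Z x) * (exp (?H x) - 1))" "integrable torus_haar (\<lambda>x. exp (?Z x))"
    using 1 2 3 by (simp_all only: spectrum_in_def)
  have zero: "(\<integral>x. (f x - ?b) * exp (?D x) \<partial>torus_haar) = 0"
    "(\<integral>x. exp (?Z x) * (exp (?H x) - 1) \<partial>torus_haar) = 0"
    using 1[unfolded spectrum_in_def, THEN conjunct2, rule_format, of 0]
      3[unfolded spectrum_in_def, THEN conjunct2, rule_format, of 0]
    by (simp_all only: fourier_0[symmetric] mem_Collect_eq d_0 less_irrefl not_False_eq_True True_implies_equals)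
  show "integrable torus_haar (\<lambda>x. f x * exp (?D x))"
    unfolding split
    by (intro Bochner_Integration.integrable_add integrable_mult_right int)
  have "(\<integral>x. f x * exp (?D x) \<partial>torus_haar) = (\<integral>x. (f x - ?b) * exp (?D x) \<partial>torus_haar) +
      ?b * (\<integral>x. exp (?Z x) * (exp (?H x) - 1) \<partial>torus_haar) + ?b * (\<integral>x. exp (?Z x) \<partial>torus_haar)"
    unfolding split integral_mult_right_zero[symmetric]
    by (simp only: Bochner_Integration.integral_add Bochner_Integration.integrable_add
        integrable_mult_right int)
  also have "\<dots> = ?b * (\<integral>x. complex_of_real (exp (- level_part N u x / 2)) \<partial>torus_haar)"
    unfolding zero unfolding exp_of_real by simp
  finally show "(\<integral>x. f x * exp (?D x) \<partial>torus_haar) =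
      ?b * complex_of_real (\<integral>x. exp (- level_part N u x / 2) \<partial>torus_haar)"
    by (simp only: integral_complex_of_real)
qed

text \<open>The inequality between degree 0 and the whole function from which everything else is derived.\<close>

lemma norm_fourier_0_le:
  assumes f: "spectrum_in Z_plus f" and u: "integrable torus_haar u"
  shows "cmod (fourier f 0) * (\<integral>x. exp (- level_part N u x / 2) \<partial>torus_haar) \<le>
    (\<integral>x. cmod (f x) * exp (- smooth N u x / 2) \<partial>torus_haar)"
proof -
  have "cmod (fourier f 0) * (\<integral>x. exp (- level_part N u x / 2) \<partial>torus_haar) =
      cmod (\<integral>x. f x * exp (- half_trig N u x) \<partial>torus_haar)"
    unfolding integral_mult_exp_half_trig[OF f] norm_mult norm_of_real
    by (simp add: integral_nonneg)
  also have "\<dots> \<le> (\<integral>x. cmod (f x * exp (- half_trig N u x)) \<partial>torus_haar)"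
    by (rule integral_norm_bound)
  also have "\<dots> = (\<integral>x. cmod (f x) * exp (- smooth N u x / 2) \<partial>torus_haar)"
    by (intro Bochner_Integration.integral_cong refl) (simp add: norm_mult Re_half_trig[OF u])
  finally show ?thesis .
qed

lemma integrable_exp_level_part: "integrable torus_haar (\<lambda>x. exp (a * level_part N u x))"
proof (rule torus.integrable_const_bound)
  let ?B = "\<Sum>n\<in>{n \<in> freqs N. d n = 0}. cmod (smooth_coeff N u n)"
  show "AE x in torus_haar. norm (exp (a * level_part N u x)) \<le> exp (\<bar>a\<bar> * ?B)"
  proof (rule AE_I2)
    fix x assume "x \<in> space torus_haar"
    then have "\<bar>level_part N u x\<bar> \<le> ?B"
      unfolding level_part_def by (rule order.trans[OF abs_Re_le_cmod norm_trig_le])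
    then have "\<bar>a\<bar> * \<bar>level_part N u x\<bar> \<le> \<bar>a\<bar> * ?B" by (intro mult_left_mono) auto
    then have "a * level_part N u x \<le> \<bar>a\<bar> * ?B"
      using abs_ge_self[of "a * level_part N u x"] unfolding abs_mult by linarith
    then show "norm (exp (a * level_part N u x)) \<le> exp (\<bar>a\<bar> * ?B)" by simp
  qed
qed measurable

end

section \<open>Jensen's inequality and its case of equality\<close>

text \<open>\<open>ln (w + e)\<close> lies between \<open>ln e\<close> and \<open>w + e\<close>.\<close>

lemma integrable_ln_add:
  assumes w: "integrable torus_haar (w :: _ \<Rightarrow> real)" and nn: "AE x in torus_haar. 0 \<le> w x" and e: "0 < e"
  shows "integrable torus_haar (\<lambda>x. ln (w x + e))"
proof (rule Bochner_Integration.integrable_bound[of _ "\<lambda>x. \<bar>ln e\<bar> + e + w x"])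
  have [measurable]: "w \<in> borel_measurable torus_haar" using w by simp
  show "(\<lambda>x. ln (w x + e)) \<in> borel_measurable torus_haar" by measurable
  show "AE x in torus_haar. norm (ln (w x + e)) \<le> norm (\<bar>ln e\<bar> + e + w x)"
    using nn
  proof eventually_elim
    case (elim x)
    have "ln (w x + e) \<le> w x + e - 1" using elim e by (intro ln_le_minus_one) simp
    moreover have "ln e \<le> ln (w x + e)" using elim e by (subst ln_le_cancel_iff) auto
    ultimately show ?case using elim e unfolding real_norm_def by linarith
  qed
qed (simp add: w)

text \<open>For \<open>e \<le> 1\<close> the regularized logarithm lies between \<open>ln w\<close> and \<open>w\<close>, an integrable bound that does
  not depend on \<open>e\<close>.\<close>

lemma ln_regularized_limits:
  assumes w: "integrable torus_haar w" and pos: "AE x in torus_haar. 0 < w x"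
    and lw: "integrable torus_haar (\<lambda>x. ln (w x))"
  shows "(\<lambda>i. \<integral>x. ln (w x + inverse (real (Suc i))) \<partial>torus_haar) \<longlonglongrightarrow> (\<integral>x. ln (w x) \<partial>torus_haar)"
    and "(\<lambda>i. fourier (\<lambda>x. complex_of_real (ln (w x + inverse (real (Suc i))))) n)
      \<longlonglongrightarrow> fourier (\<lambda>x. complex_of_real (ln (w x))) n"
proof -
  have [measurable]: "w \<in> borel_measurable torus_haar" using w by simp
  let ?e = "\<lambda>i. inverse (real (Suc i))"
  let ?b = "\<lambda>x. \<bar>ln (w x)\<bar> + w x"
  have b: "integrable torus_haar ?b" using w lw by simp
  have lim: "AE x in torus_haar. (\<lambda>i. ln (w x + ?e i)) \<longlonglongrightarrow> ln (w x)"
    using pos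
  proof eventually_elim
    case (elim x)
    have "(\<lambda>i. ln (w x + ?e i)) \<longlonglongrightarrow> ln (w x + 0)"
      using elim by (intro tendsto_intros LIMSEQ_inverse_real_of_nat) auto
    then show ?case by simp
  qed
  have bound: "AE x in torus_haar. \<bar>ln (w x + ?e i)\<bar> \<le> ?b x" for i
    using pos
  proof eventually_elim
    case (elim x)
    have e: "0 < ?e i" "?e i \<le> 1" by (simp_all add: field_simps)
    have "ln (w x + ?e i) \<le> w x + ?e i - 1" by (rule ln_le_minus_one[OF add_pos_pos[OF elim e(1)]])
    moreover have "ln (w x) \<le> ln (w x + ?e i)"
      using ln_le_cancel_iff[OF elim add_pos_pos[OF elim e(1)]] e by linarith
    ultimately show ?case using elim e by linarith
  qed
  show "(\<lambda>i. \<integral>x. ln (w x + ?e i) \<partial>torus_haar) \<longlonglongrightarrow> (\<integral>x. ln (w x) \<partial>torus_haar)"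
    by (rule integral_dominated_convergence[where w = ?b]) (use b lim bound in auto)
  show "(\<lambda>i. fourier (\<lambda>x. complex_of_real (ln (w x + ?e i))) n)
      \<longlonglongrightarrow> fourier (\<lambda>x. complex_of_real (ln (w x))) n"
    unfolding fourier_def
  proof (rule integral_dominated_convergence[where w = ?b])
    show "AE x in torus_haar. (\<lambda>i. complex_of_real (ln (w x + ?e i)) * cnj (character n x))
        \<longlonglongrightarrow> complex_of_real (ln (w x)) * cnj (character n x)"
      using lim by eventually_elim (intro tendsto_mult_right tendsto_of_real)
    show "AE x in torus_haar. norm (complex_of_real (ln (w x + ?e i)) * cnj (character n x)) \<le> ?b x" for i
      using bound[of i] AE_space
      by eventually_elim (simp only: norm_mult norm_of_real complex_mod_cnj norm_character mult_1_right)
  qed (use b in auto)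
qed

text \<open>Convexity of the exponential, through its tangents at \<open>\<theta>\<close> and \<open>- \<theta>\<close>.\<close>

lemma abs_le_exp_excess:
  fixes t \<theta> :: real
  assumes "0 < \<theta>"
  shows "\<bar>t\<bar> \<le> \<theta> + (exp t - 1 - t) / (1 - exp (- \<theta>))"
proof -
  have k: "0 < 1 - exp (- \<theta>)" using assms by simp
  have tangent: "exp a * (1 + (t - a)) \<le> exp t" for a
    using exp_ge_add_one_self[of "t - a"] by (simp add: exp_diff field_simps)
  have nonneg: "0 \<le> exp t - 1 - t" using exp_ge_add_one_self[of t] by linarith
  have "(\<bar>t\<bar> - \<theta>) * (1 - exp (- \<theta>)) \<le> exp t - 1 - t"
  proof (cases "\<bar>t\<bar> \<le> \<theta>")
    case True
    then have "(\<bar>t\<bar> - \<theta>) * (1 - exp (- \<theta>)) \<le> 0" using k by (intro mult_nonpos_nonneg) auto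
    then show ?thesis using nonneg by linarith
  next
    case False
    show ?thesis
    proof (cases "0 \<le> t")
      case True
      have "exp (- \<theta>) + exp \<theta> \<ge> 2"
        using exp_ge_add_one_self[of "\<theta>"] exp_ge_add_one_self[of "- \<theta>"] by linarith
      then have "(t - \<theta>) * (1 - exp (- \<theta>)) \<le> (t - \<theta>) * (exp \<theta> - 1)"
        using False True by (intro mult_left_mono) auto
      also have "\<dots> \<le> exp t - 1 - t"
        using tangent[of \<theta>] exp_ge_add_one_self[of \<theta>] unfolding ring_distribs mult_1_right
        by (simp only: mult.commute[of t] mult.commute[of \<theta>])
      finally show ?thesis using True by simp
    next
      case f: False
      have "(- t - \<theta>) * (1 - exp (- \<theta>)) \<le> exp t - 1 - t"
        using tangent[of "- \<theta>"] exp_ge_add_one_self[of "- \<theta>"]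
        unfolding ring_distribs mult_1_right mult_minus_left mult_minus_right
        by (simp only: mult.commute[of t] mult.commute[of \<theta>])
      then show ?thesis using f by simp
    qed
  qed
  then have "\<bar>t\<bar> - \<theta> \<le> (exp t - 1 - t) / (1 - exp (- \<theta>))"
    using k by (simp add: pos_le_divide_eq)
  then show ?thesis by simp
qed

context positive_grading
begin

text \<open>Put \<open>u = L\<close> in \<open>norm_fourier_0_le\<close>. Since \<open>L \<ge> ln e\<close>, its Fejer means are bounded below by the
  same constant, so \<open>\<bar>f\<bar> / sqrt e\<close> dominates the right-hand sides, which tend to
  \<open>\<integral> \<bar>f\<bar> / sqrt (\<bar>f\<bar>\<^sup>2 + e) \<le> 1\<close> along a subsequence.\<close>

lemma exp_level_part_limit:
  assumes f: "spectrum_in Z_plus f" and sq: "integrable torus_haar (\<lambda>x. (cmod (f x))\<^sup>2)" and e: "0 < e"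
  defines "L \<equiv> \<lambda>x. ln ((cmod (f x))\<^sup>2 + e)"
  obtains r where "strict_mono r"
    and "\<And>\<delta>. 0 < \<delta> \<Longrightarrow> eventually (\<lambda>j. cmod (fourier f 0) *
      (\<integral>x. exp (- level_part (r j) L x / 2) \<partial>torus_haar) \<le> 1 + \<delta>) sequentially"
proof -
  have fi: "integrable torus_haar f" using f by (simp add: spectrum_in_def)
  then have [measurable]: "f \<in> borel_measurable torus_haar" by simp
  have L: "integrable torus_haar L"
    unfolding L_def using sq e by (intro integrable_ln_add) auto
  then have [measurable]: "L \<in> borel_measurable torus_haar" by simp
  have [measurable]: "smooth N L \<in> borel_measurable torus_haar" for N
    using integrable_smooth[OF L] by simp
  have L_ge: "ln e \<le> L x" for x
    unfolding L_def using e by (subst ln_le_cancel_iff) (auto intro: add_nonneg_pos)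
  have smooth_ge: "ln e \<le> smooth N L x" if x: "x \<in> space torus_haar" for N x
    using smooth_mono[of "\<lambda>_. ln e" L x N] L L_ge x by (simp add: smooth_const)
  obtain r where r: "strict_mono r" "AE x in torus_haar. (\<lambda>i. smooth (r i) L x) \<longlonglongrightarrow> L x"
    using smooth_AE_subsequence[OF L] by blast
  let ?I = "\<integral>x. cmod (f x) * exp (- L x / 2) \<partial>torus_haar"
  have lim: "(\<lambda>i. \<integral>x. cmod (f x) * exp (- smooth (r i) L x / 2) \<partial>torus_haar) \<longlonglongrightarrow> ?I"
  proof (rule integral_dominated_convergence[where w = "\<lambda>x. cmod (f x) * exp (- ln e / 2)"])
    show "AE x in torus_haar. (\<lambda>i. cmod (f x) * exp (- smooth (r i) L x / 2)) \<longlonglongrightarrow> cmod (f x) * exp (- L x / 2)"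
      using r(2) by eventually_elim (intro tendsto_intros, auto)
    show "AE x in torus_haar. norm (cmod (f x) * exp (- smooth (r i) L x / 2)) \<le> cmod (f x) * exp (- ln e / 2)" for i
      using smooth_ge by (intro AE_I2) (simp add: abs_mult mult_left_mono)
  qed (use fi in auto)
  have "?I \<le> (\<integral>x. 1 \<partial>torus_haar)"
  proof (rule integral_mono_AE)
    have le1: "cmod (f x) * exp (- L x / 2) \<le> 1" for x
    proof -
      have "(cmod (f x) * exp (- L x / 2))\<^sup>2 = (cmod (f x))\<^sup>2 * exp (- L x)"
        by (simp add: power_mult_distrib power2_eq_square flip: exp_add)
      also have "\<dots> = (cmod (f x))\<^sup>2 / ((cmod (f x))\<^sup>2 + e)"
        using e exp_ln[of "(cmod (f x))\<^sup>2 + e"]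
        by (simp only: L_def exp_minus divide_inverse add_nonneg_pos zero_le_power2)
      also have "\<dots> \<le> 1" using e by (simp add: add_nonneg_pos divide_le_eq)
      finally show ?thesis by (simp add: power2_le_iff_abs_le abs_square_le_1)
    qed
    then show "AE x in torus_haar. cmod (f x) * exp (- L x / 2) \<le> 1" by simp
    show "integrable torus_haar (\<lambda>x. cmod (f x) * exp (- L x / 2))"
      by (rule torus.integrable_const_bound[of _ 1]) (use le1 in \<open>auto simp: abs_mult\<close>)
  qed simp
  then have I: "?I \<le> 1" by (simp add: torus.prob_space)
  show ?thesis
  proof (rule that[OF r(1)])
    fix \<delta> :: real assume "0 < \<delta>"
    then have "eventually (\<lambda>i. (\<integral>x. cmod (f x) * exp (- smooth (r i) L x / 2) \<partial>torus_haar) < 1 + \<delta>) sequentially"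
      using order_tendstoD(2)[OF lim, of "1 + \<delta>"] I by simp
    then show "eventually (\<lambda>j. cmod (fourier f 0) *
        (\<integral>x. exp (- level_part (r j) L x / 2) \<partial>torus_haar) \<le> 1 + \<delta>) sequentially"
    proof eventually_elim
      case (elim i)
      then show ?case using norm_fourier_0_le[OF f L, of "r i"] by linarith
    qed
  qed
qed

lemma mult_exp_level_part:
  assumes "0 < c"
  shows "c * (\<integral>x. exp (- level_part N u x / 2) \<partial>torus_haar) =
    (\<integral>x. exp (ln c - level_part N u x / 2) \<partial>torus_haar)"
proof -
  have "c * exp (- l / 2) = exp (ln c - l / 2)" for l
    using assms exp_add[of "ln c" "- l / 2"] by simp
  then show ?thesis by (simp only: integral_mult_right_zero[symmetric])
qed

lemma integrable_exp_ln_level_part: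
  "integrable torus_haar (\<lambda>x. exp (a - level_part N u x / 2))"
proof -
  have "exp (a - level_part N u x / 2) = exp a * exp ((- 1 / 2) * level_part N u x)" for x
    by (simp flip: exp_add)
  then show ?thesis using integrable_exp_level_part[of "- 1 / 2" N u] by simp
qed

text \<open>Jensen's inequality for analytic functions, from \<open>exp t \<ge> 1 + t\<close> in \<open>exp_level_part_limit\<close> and
  the fact that \<open>L\<close> and its part of degree 0 have the same mean. Zeros of \<open>f\<close> need no attention,
  because \<open>e\<close> keeps the logarithm bounded below.\<close>

lemma jensen_regularized:
  assumes f: "spectrum_in Z_plus f" and sq: "integrable torus_haar (\<lambda>x. (cmod (f x))\<^sup>2)" and e: "0 < e"
    and nz: "fourier f 0 \<noteq> 0"
  shows "2 * ln (cmod (fourier f 0)) \<le> (\<integral>x. ln ((cmod (f x))\<^sup>2 + e) \<partial>torus_haar)"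
proof (rule field_le_epsilon)
  fix \<delta>' :: real assume "0 < \<delta>'"
  define \<delta> where "\<delta> = \<delta>' / 2"
  have \<delta>: "0 < \<delta>" using \<open>0 < \<delta>'\<close> by (simp add: \<delta>_def)
  define L where "L = (\<lambda>x. ln ((cmod (f x))\<^sup>2 + e))"
  define c where "c = cmod (fourier f 0)"
  have c: "0 < c" using nz by (simp add: c_def)
  obtain r where "\<And>\<delta>. 0 < \<delta> \<Longrightarrow> eventually (\<lambda>j. c *
      (\<integral>x. exp (- level_part (r j) L x / 2) \<partial>torus_haar) \<le> 1 + \<delta>) sequentially"
    using exp_level_part_limit[OF f sq e, folded L_def c_def] by blast
  from this[OF \<delta>] have r: "eventually (\<lambda>j. c *
      (\<integral>x. exp (- level_part (r j) L x / 2) \<partial>torus_haar) \<le> 1 + \<delta>) sequentially" .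
  from r obtain j where "c * (\<integral>x. exp (- level_part (r j) L x / 2) \<partial>torus_haar) \<le> 1 + \<delta>"
    by (auto simp: eventually_sequentially)
  then have "(\<integral>x. exp (ln c - level_part (r j) L x / 2) \<partial>torus_haar) \<le> 1 + \<delta>"
    by (simp only: mult_exp_level_part[OF c])
  moreover have "(\<integral>x. 1 + (ln c - level_part (r j) L x / 2) \<partial>torus_haar) \<le>
      (\<integral>x. exp (ln c - level_part (r j) L x / 2) \<partial>torus_haar)"
    by (intro integral_mono integrable_exp_ln_level_part exp_ge_add_one_self) auto
  moreover have "(\<integral>x. 1 + (ln c - level_part (r j) L x / 2) \<partial>torus_haar) = 1 + ln c - (\<integral>x. L x \<partial>torus_haar) / 2"
    by (simp add: integral_level_part torus.prob_space)
  ultimately have "2 * ln c \<le> (\<integral>x. L x \<partial>torus_haar) + 2 * \<delta>" by linarith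
  then show "2 * ln (cmod (fourier f 0)) \<le> (\<integral>x. ln ((cmod (f x))\<^sup>2 + e) \<partial>torus_haar) + \<delta>'"
    by (simp add: c_def L_def \<delta>_def)
qed

text \<open>The defect in Jensen's inequality bounds the nonconstant part of degree 0 of the logarithm: for
  \<open>t = ln c - level_part / 2\<close>, the integral of \<open>exp t - 1 - t\<close> is, up to an error \<open>\<delta>\<close>, at most half the
  defect, and by \<open>abs_le_exp_excess\<close> it controls the integral of \<open>\<bar>t\<bar>\<close>.\<close>

lemma jensen_stability_regularized:
  assumes f: "spectrum_in Z_plus f" and sq: "integrable torus_haar (\<lambda>x. (cmod (f x))\<^sup>2)" and e: "0 < e"
    and nz: "fourier f 0 \<noteq> 0" and n: "d n = 0" "n \<noteq> 0" and \<theta>: "0 < \<theta>"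
  shows "cmod (fourier (\<lambda>x. complex_of_real (ln ((cmod (f x))\<^sup>2 + e))) n) \<le> 2 * \<theta> +
    ((\<integral>x. ln ((cmod (f x))\<^sup>2 + e) \<partial>torus_haar) - 2 * ln (cmod (fourier f 0))) / (1 - exp (- \<theta>))"
proof (rule field_le_epsilon)
  fix \<delta>' :: real assume "0 < \<delta>'"
  define L where "L = (\<lambda>x. ln ((cmod (f x))\<^sup>2 + e))"
  define c where "c = cmod (fourier f 0)"
  define k where "k = 1 - exp (- \<theta>)"
  have k: "0 < k" using \<theta> by (simp add: k_def)
  define \<delta> where "\<delta> = \<delta>' * k / 2"
  have \<delta>: "0 < \<delta>" using \<open>0 < \<delta>'\<close> k by (simp add: \<delta>_def)
  have c: "0 < c" using nz by (simp add: c_def)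
  obtain r where sm: "strict_mono r" and ev: "\<And>\<delta>. 0 < \<delta> \<Longrightarrow> eventually (\<lambda>j. c *
      (\<integral>x. exp (- level_part (r j) L x / 2) \<partial>torus_haar) \<le> 1 + \<delta>) sequentially"
    using exp_level_part_limit[OF f sq e, folded L_def c_def] by blast
  note r = sm ev[OF \<delta>]
  let ?b = "2 * (\<theta> + (\<delta> + (\<integral>x. L x \<partial>torus_haar) / 2 - ln c) / k)"
  have le: "eventually (\<lambda>j. cmod (smooth_coeff (r j) L n) \<le> ?b) sequentially"
    using r(2)
  proof eventually_elim
    case (elim j)
    let ?t = "\<lambda>x. ln c - level_part (r j) L x / 2"
    have exp_t: "(\<integral>x. exp (?t x) \<partial>torus_haar) \<le> 1 + \<delta>"
      using elim by (simp only: mult_exp_level_part[OF c])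
    have "fourier (\<lambda>x. complex_of_real (?t x)) n =
        fourier (\<lambda>x. complex_of_real (ln c) + (- 1 / 2) * complex_of_real (level_part (r j) L x)) n"
      by simp
    also have "\<dots> = fourier (\<lambda>x. complex_of_real (ln c)) n + (- 1 / 2) * smooth_coeff (r j) L n"
      using fourier_cmult[of "- 1 / 2" "\<lambda>x. complex_of_real (level_part (r j) L x)" n]
      by (subst fourier_add) (simp_all add: fourier_level_part[OF n(1)])
    also have "fourier (\<lambda>x. complex_of_real (ln c)) n = 0"
      using fourier_cmult[of "complex_of_real (ln c)" "character 0" n] n(2) by (simp add: fourier_character)
    finally have "smooth_coeff (r j) L n = (- 2) * fourier (\<lambda>x. complex_of_real (?t x)) n" by simp
    then have "cmod (smooth_coeff (r j) L n) = 2 * cmod (fourier (\<lambda>x. complex_of_real (?t x)) n)"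
      by (simp only: norm_mult) simp
    also have "\<dots> \<le> 2 * (\<integral>x. \<bar>?t x\<bar> \<partial>torus_haar)"
      using norm_fourier_le[of "\<lambda>x. complex_of_real (?t x)" n] by (simp only: norm_of_real)
    also have "(\<integral>x. \<bar>?t x\<bar> \<partial>torus_haar) \<le> (\<integral>x. \<theta> + (exp (?t x) - 1 - ?t x) / k \<partial>torus_haar)"
      unfolding k_def
      by (intro integral_mono abs_le_exp_excess \<theta> integrable_abs Bochner_Integration.integrable_add
          Bochner_Integration.integrable_diff integrable_divide integrable_exp_ln_level_part
          integrable_level_part torus.integrable_const)
    also have "\<dots> = \<theta> + ((\<integral>x. exp (?t x) \<partial>torus_haar) - 1 - (\<integral>x. ?t x \<partial>torus_haar)) / k"
      using integrable_exp_ln_level_part[of "ln c" "r j" L] by (simp add: torus.prob_space)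
    also have "(\<integral>x. ?t x \<partial>torus_haar) = ln c - (\<integral>x. L x \<partial>torus_haar) / 2"
      by (simp add: integral_level_part torus.prob_space)
    also have "\<theta> + ((\<integral>x. exp (?t x) \<partial>torus_haar) - 1 - (ln c - (\<integral>x. L x \<partial>torus_haar) / 2)) / k \<le>
        \<theta> + (\<delta> + (\<integral>x. L x \<partial>torus_haar) / 2 - ln c) / k"
      using exp_t k by (intro add_left_mono divide_right_mono) auto
    finally show ?case by simp
  qed
  have "(\<lambda>j. smooth_coeff (r j) L n) \<longlonglongrightarrow> complex_of_real 1 * fourier (\<lambda>x. complex_of_real (L x)) n"
    unfolding smooth_coeff_def
    by (intro tendsto_intros LIMSEQ_subseq_LIMSEQ[OF fejer_tendsto_1 r(1), unfolded comp_def])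
  then have "(\<lambda>j. cmod (smooth_coeff (r j) L n)) \<longlonglongrightarrow> cmod (fourier (\<lambda>x. complex_of_real (L x)) n)"
    by (intro tendsto_norm) simp
  then have "cmod (fourier (\<lambda>x. complex_of_real (L x)) n) \<le> ?b"
    by (rule tendsto_upperbound[OF _ le]) simp
  also have "?b = 2 * \<theta> + ((\<integral>x. L x \<partial>torus_haar) - 2 * ln c) / k + \<delta>'"
    using k by (simp add: \<delta>_def field_simps)
  finally show "cmod (fourier (\<lambda>x. complex_of_real (ln ((cmod (f x))\<^sup>2 + e))) n) \<le> 2 * \<theta> +
    ((\<integral>x. ln ((cmod (f x))\<^sup>2 + e) \<partial>torus_haar) - 2 * ln (cmod (fourier f 0))) / (1 - exp (- \<theta>)) + \<delta>'"
    by (simp only: L_def c_def k_def)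
qed

text \<open>Equality in Jensen's inequality makes the bound of \<open>jensen_stability_regularized\<close> tend to \<open>2 \<theta>\<close> as
  \<open>e \<rightarrow> 0\<close>, for every positive \<open>\<theta>\<close>.\<close>

lemma fourier_log_eq_0:
  assumes f: "spectrum_in Z_plus f" and sq: "integrable torus_haar (\<lambda>x. (cmod (f x))\<^sup>2)"
    and pos: "AE x in torus_haar. 0 < (cmod (f x))\<^sup>2"
    and ln_int: "integrable torus_haar (\<lambda>x. ln ((cmod (f x))\<^sup>2))"
    and eq: "(\<integral>x. ln ((cmod (f x))\<^sup>2) \<partial>torus_haar) = 2 * ln (cmod (fourier f 0))"
    and nz: "fourier f 0 \<noteq> 0" and n: "d n = 0" "n \<noteq> 0"
  shows "fourier (\<lambda>x. complex_of_real (ln ((cmod (f x))\<^sup>2))) n = 0"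
proof -
  let ?e = "\<lambda>i. inverse (real (Suc i))"
  have "cmod (fourier (\<lambda>x. complex_of_real (ln ((cmod (f x))\<^sup>2))) n) \<le> 0 + \<delta>" if "0 < \<delta>" for \<delta>
  proof -
    define \<theta> where "\<theta> = \<delta> / 2"
    have \<theta>: "0 < \<theta>" using that by (simp add: \<theta>_def)
    note lims = ln_regularized_limits[OF sq pos ln_int]
    have "(\<lambda>i. 2 * \<theta> + ((\<integral>x. ln ((cmod (f x))\<^sup>2 + ?e i) \<partial>torus_haar) - 2 * ln (cmod (fourier f 0))) / (1 - exp (- \<theta>)))
        \<longlonglongrightarrow> 2 * \<theta> + ((\<integral>x. ln ((cmod (f x))\<^sup>2) \<partial>torus_haar) - 2 * ln (cmod (fourier f 0))) / (1 - exp (- \<theta>))"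
      using \<theta> by (intro tendsto_intros lims(1)) auto
    then have "cmod (fourier (\<lambda>x. complex_of_real (ln ((cmod (f x))\<^sup>2))) n) \<le>
        2 * \<theta> + ((\<integral>x. ln ((cmod (f x))\<^sup>2) \<partial>torus_haar) - 2 * ln (cmod (fourier f 0))) / (1 - exp (- \<theta>))"
      by (rule LIMSEQ_le[OF tendsto_norm[OF lims(2)]])
         (use jensen_stability_regularized[OF f sq _ nz n \<theta>] in auto)
    then show ?thesis by (simp add: eq \<theta>_def)
  qed
  then have "cmod (fourier (\<lambda>x. complex_of_real (ln ((cmod (f x))\<^sup>2))) n) \<le> 0"
    by (rule field_le_epsilon)
  then show ?thesis by simp
qed

end

lemma positive_grading_weighted_degree:
  fixes a :: "nat \<Rightarrow> int"
  assumes a: "\<And>k. 0 < a k"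
  shows "positive_grading (\<lambda>n. \<Sum>k\<in>keys n. a k * lookup n k)"
proof
  fix m n :: "nat \<Rightarrow>\<^sub>0 int"
  have *: "(\<Sum>k\<in>keys l. a k * lookup l k) = (\<Sum>k\<in>keys m \<union> keys n. a k * lookup l k)"
    if "keys l \<subseteq> keys m \<union> keys n" for l
    using that by (intro sum.mono_neutral_left) (auto simp: in_keys_iff)
  show "(\<Sum>k\<in>keys (m + n). a k * lookup (m + n) k) =
      (\<Sum>k\<in>keys m. a k * lookup m k) + (\<Sum>k\<in>keys n. a k * lookup n k)"
    using *[of "m + n"] *[of m] *[of n] Poly_Mapping.keys_add[of m n]
    by (simp add: lookup_add distrib_left sum.distrib)
next
  fix n :: "nat \<Rightarrow>\<^sub>0 int" assume n: "n \<in> Z_plus" "n \<noteq> 0"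
  have "lookup n k > 0" if "k \<in> keys n" for k
    using n(1) that by (auto simp: Z_plus_def in_keys_iff order.not_eq_order_implies_strict[of 0])
  then show "0 < (\<Sum>k\<in>keys n. a k * lookup n k)"
    using n(2) a by (intro sum_pos) auto
qed

text \<open>A frequency with entries of both signs has degree 0 for suitable positive weights: weigh the
  positive entries by the total of the negative ones and conversely.\<close>

lemma exists_positive_grading_eq_0:
  assumes n: "n \<notin> Z_plus \<union> uminus ` Z_plus"
  obtains d where "positive_grading d" "d n = 0"
proof -
  have "n \<notin> Z_plus" "- n \<notin> Z_plus"
    using n by (auto simp: image_iff)
  then obtain i j where i: "lookup n i < 0" and j: "0 < lookup n j"
    by (auto simp: Z_plus_def not_le)
  let ?P = "{k \<in> keys n. 0 < lookup n k}" and ?Q = "{k \<in> keys n. lookup n k < 0}"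
  define p where "p = (\<Sum>k\<in>?P. lookup n k)"
  define q where "q = (\<Sum>k\<in>?Q. - lookup n k)"
  have p: "0 < p" unfolding p_def using j by (intro sum_pos) (auto simp: in_keys_iff intro!: exI[of _ j])
  have q: "0 < q" unfolding q_def using i by (intro sum_pos) (auto simp: in_keys_iff intro!: exI[of _ i])
  define a where "a k = (if 0 < lookup n k then q else p)" for k
  have "keys n = ?P \<union> ?Q" by (auto simp: in_keys_iff)
  then have "(\<Sum>k\<in>keys n. a k * lookup n k) = (\<Sum>k\<in>?P \<union> ?Q. a k * lookup n k)" by simp
  also have "\<dots> = (\<Sum>k\<in>?P. a k * lookup n k) + (\<Sum>k\<in>?Q. a k * lookup n k)"
    by (intro sum.union_disjoint) auto
  also have "(\<Sum>k\<in>?P. a k * lookup n k) = q * p"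
    by (simp add: a_def p_def sum_distrib_left)
  also have "(\<Sum>k\<in>?Q. a k * lookup n k) = (\<Sum>k\<in>?Q. - (p * - lookup n k))"
    by (intro sum.cong) (auto simp: a_def)
  also have "\<dots> = - (p * q)"
    by (simp add: q_def sum_negf sum_distrib_left)
  finally have "(\<Sum>k\<in>keys n. a k * lookup n k) = 0" by simp
  moreover have "positive_grading (\<lambda>n. \<Sum>k\<in>keys n. a k * lookup n k)"
    by (rule positive_grading_weighted_degree) (simp add: a_def p q)
  ultimately show ?thesis using that by blast
qed

section \<open>Construction of the outer function\<close>

lemma integrable_of_square_integrable:
  assumes [measurable]: "f \<in> borel_measurable torus_haar"
    and "integrable torus_haar (\<lambda>x. (cmod (f x))\<^sup>2)"
  shows "integrable torus_haar f"
proof (rule Bochner_Integration.integrable_bound[of _ "\<lambda>x. 1 + (cmod (f x))\<^sup>2"])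
  have "t \<le> 1 + t\<^sup>2" for t :: real
  proof -
    have "(t - 1 / 2)\<^sup>2 = t\<^sup>2 - t + 1 / 4" by (simp add: power2_eq_square algebra_simps)
    then show ?thesis using zero_le_power2[of "t - 1 / 2"] by linarith
  qed
  then show "AE x in torus_haar. norm (f x) \<le> norm (1 + (cmod (f x))\<^sup>2)"
    by (intro AE_I2) (simp add: abs_of_nonneg add_nonneg_nonneg)
qed (use assms(2) in auto)

text \<open>Splitting \<open>\<bar>h\<bar> \<le> min M \<bar>h\<bar> + \<bar>h\<bar>\<^sup>2 / M\<close>, the first part is handled by bounded convergence and
  the second is small, uniformly in the index, for large \<open>M\<close>.\<close>

lemma L1_tendsto_0_of_L2_bounded:
  assumes [measurable]: "\<And>i. h i \<in> borel_measurable torus_haar"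
    and sq: "\<And>i. integrable torus_haar (\<lambda>x. (cmod (h i x))\<^sup>2)"
    and C: "\<And>i. (\<integral>x. (cmod (h i x))\<^sup>2 \<partial>torus_haar) \<le> C"
    and lim: "AE x in torus_haar. (\<lambda>i. h i x) \<longlonglongrightarrow> 0"
  shows "(\<lambda>i. \<integral>x. cmod (h i x) \<partial>torus_haar) \<longlonglongrightarrow> 0"
proof (rule LIMSEQ_I)
  fix e :: real assume e: "0 < e"
  have int: "integrable torus_haar (h i)" for i
    by (rule integrable_of_square_integrable[OF _ sq]) simp
  define M where "M = 2 * (\<bar>C\<bar> + 1) / e"
  have "0 < M" "e / 2 * M = \<bar>C\<bar> + 1" using e by (auto simp: M_def)
  then have M: "0 < M" "C / M < e / 2" by (auto simp: pos_divide_less_eq)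
  have intm: "integrable torus_haar (\<lambda>x. min M (cmod (h i x)))" for i
    by (rule torus.integrable_const_bound[of _ M]) (use M in auto)
  have "(\<lambda>i. \<integral>x. min M (cmod (h i x)) \<partial>torus_haar) \<longlonglongrightarrow> (\<integral>x. 0 \<partial>torus_haar)"
  proof (rule integral_dominated_convergence[where w = "\<lambda>_. M"])
    show "AE x in torus_haar. (\<lambda>i. min M (cmod (h i x))) \<longlonglongrightarrow> 0"
      using lim
    proof eventually_elim
      case (elim x)
      have "(\<lambda>i. min M (cmod (h i x))) \<longlonglongrightarrow> min M (cmod 0)"
        by (intro tendsto_min tendsto_const tendsto_norm elim)
      then show ?case using M by simp
    qed
  qed (use M in auto)
  from LIMSEQ_D[OF this, of "e / 2"] e obtain K where
    K: "\<And>i. i \<ge> K \<Longrightarrow> norm ((\<integral>x. min M (cmod (h i x)) \<partial>torus_haar) - (\<integral>x. 0 \<partial>torus_haar)) < e / 2"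
    by auto
  have "norm ((\<integral>x. cmod (h i x) \<partial>torus_haar) - 0) < e" if i: "i \<ge> K" for i
  proof -
    have split: "t \<le> min M t + t\<^sup>2 / M" if "0 \<le> t" for t
    proof (cases "t \<le> M")
      case True
      then show ?thesis using M that by simp
    next
      case False
      then have "t * M \<le> t\<^sup>2" using M by (simp add: power2_eq_square mult_left_mono)
      then have "t \<le> t\<^sup>2 / M" using M by (simp add: pos_le_divide_eq)
      then show ?thesis using False M by simp
    qed
    have "(\<integral>x. cmod (h i x) \<partial>torus_haar) \<le> (\<integral>x. min M (cmod (h i x)) + (cmod (h i x))\<^sup>2 / M \<partial>torus_haar)"
      using int intm sq by (intro integral_mono split) auto
    also have "\<dots> = (\<integral>x. min M (cmod (h i x)) \<partial>torus_haar) + (\<integral>x. (cmod (h i x))\<^sup>2 \<partial>torus_haar) / M"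
      using intm[of i] sq[of i] by simp
    also have "(\<integral>x. (cmod (h i x))\<^sup>2 \<partial>torus_haar) / M \<le> C / M"
      using C[of i] M by (intro divide_right_mono) auto
    finally have "(\<integral>x. cmod (h i x) \<partial>torus_haar) \<le>
        (\<integral>x. min M (cmod (h i x)) \<partial>torus_haar) + C / M" by simp
    moreover have "(\<integral>x. min M (cmod (h i x)) \<partial>torus_haar) < e / 2"
      using K[OF i] by (auto simp: abs_less_iff)
    ultimately have "(\<integral>x. cmod (h i x) \<partial>torus_haar) < e" using M(2) by linarith
    then show ?thesis by simp
  qed
  then show "\<exists>K. \<forall>i\<ge>K. norm ((\<integral>x. cmod (h i x) \<partial>torus_haar) - 0) < e" by blast
qed

text \<open>Two numbers of squared modulus at most about \<open>W\<close> whose midpoint also has squared modulus about \<open>W\<close>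
  are close, by the parallelogram law. Here "about \<open>W\<close>" is measured for the midpoint by the defect
  \<open>ln (W + \<epsilon>) - ln (\<bar>midpoint\<bar>\<^sup>2 + \<epsilon>)\<close>, whose integral Jensen's inequality controls. The estimate is
  first made for \<open>\<bar>a - b\<bar>\<^sup>2 / (W + \<epsilon>)\<close>; the free parameter \<open>\<tau>\<close> comes from passing to the first power
  by the inequality of arithmetic and geometric means.\<close>

lemma norm_diff_le_ln_defect:
  fixes a b :: complex and W A B \<epsilon> \<tau> :: real
  assumes W: "0 \<le> W" and \<epsilon>: "0 < \<epsilon>" "\<epsilon> \<le> 1" and \<tau>: "0 < \<tau>" and A: "0 \<le> A" "(cmod a)\<^sup>2 \<le> W + A"
    and B: "0 \<le> B" "(cmod b)\<^sup>2 \<le> W + B"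
  shows "cmod (a - b) \<le> \<tau> / 2 * (W + 1) +
    (A + B) / (\<tau> * \<epsilon>) + 2 / \<tau> * (ln (W + \<epsilon>) - ln ((cmod ((a + b) / 2))\<^sup>2 + \<epsilon>))"
proof -
  define D where "D = cmod (a - b)"
  define F where "F = (cmod ((a + b) / 2))\<^sup>2"
  define P where "P = W + \<epsilon>"
  have P: "0 < P" "\<epsilon> \<le> P" "P \<le> W + 1" and F: "0 \<le> F" using W \<epsilon> by (auto simp: P_def F_def)
  have "D\<^sup>2 + 4 * F = 2 * (cmod a)\<^sup>2 + 2 * (cmod b)\<^sup>2"
    unfolding D_def F_def norm_divide power_divide cmod_power2
    by (simp add: power2_eq_square algebra_simps)
  then have D2: "D\<^sup>2 \<le> 4 * P + 2 * (A + B) - 4 * (F + \<epsilon>)"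
    using A B by (simp add: P_def)
  have "D\<^sup>2 / P \<le> (4 * P + 2 * (A + B) - 4 * (F + \<epsilon>)) / P"
    using D2 P by (intro divide_right_mono) auto
  also have "\<dots> = 4 + 2 * (A + B) / P - 4 * ((F + \<epsilon>) / P)"
    using P by (simp add: add_divide_distrib diff_divide_distrib)
  finally have 1: "D\<^sup>2 / P \<le> 4 + 2 * (A + B) / P - 4 * ((F + \<epsilon>) / P)" .
  have 2: "2 * (A + B) / P \<le> 2 * (A + B) / \<epsilon>"
    using A B P \<epsilon> by (intro divide_left_mono) auto
  have 3: "ln (F + \<epsilon>) - ln P \<le> (F + \<epsilon>) / P - 1"
    using ln_le_minus_one[of "(F + \<epsilon>) / P"] P F \<epsilon> by (simp add: ln_div add_nonneg_pos)
  have D2P: "D\<^sup>2 / P \<le> 2 * (A + B) / \<epsilon> + 4 * (ln P - ln (F + \<epsilon>))"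
  proof -
    have "y \<le> b + 4 * (p - q)" if "y \<le> 4 + a - 4 * c" "a \<le> b" "q - p \<le> c - 1" for a b c p q y :: real
      using that by argo
    from this[OF 1 2 3] show ?thesis .
  qed
  \<comment> \<open>From \<open>\<bar>a - b\<bar>\<^sup>2 / P\<close> to \<open>\<bar>a - b\<bar>\<close>, by the inequality of arithmetic and geometric means.\<close>
  have "0 \<le> (\<tau> * P - D)\<^sup>2" by simp
  then have "2 * \<tau> * P * D \<le> \<tau>\<^sup>2 * P\<^sup>2 + D\<^sup>2"
    by (simp add: power2_diff power_mult_distrib mult_ac)
  then have "D \<le> (\<tau>\<^sup>2 * P\<^sup>2 + D\<^sup>2) / (2 * \<tau> * P)"
    using P \<tau> by (simp add: pos_le_divide_eq mult_ac)
  also have "\<dots> = \<tau> / 2 * P + (D\<^sup>2 / P) / (2 * \<tau>)"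
    using P \<tau> by (simp add: field_simps power2_eq_square)
  also have "\<dots> \<le> \<tau> / 2 * (W + 1) + (2 * (A + B) / \<epsilon> + 4 * (ln P - ln (F + \<epsilon>))) / (2 * \<tau>)"
    using P \<tau> D2P by (intro add_mono mult_left_mono divide_right_mono) auto
  also have "\<dots> = \<tau> / 2 * (W + 1) + (A + B) / (\<tau> * \<epsilon>) + 2 / \<tau> * (ln P - ln (F + \<epsilon>))"
    using \<tau> \<epsilon> by (simp add: field_simps)
  finally show ?thesis by (simp only: D_def P_def F_def)
qed

context positive_grading
begin

context
  fixes u :: "(nat \<Rightarrow> complex) \<Rightarrow> real"
  assumes u: "integrable torus_haar u" and eu: "integrable torus_haar (\<lambda>x. exp (u x))"
    and supp: "\<And>n. n \<notin> Z_plus \<union> uminus ` Z_plus \<Longrightarrow> fourier (\<lambda>x. complex_of_real (u x)) n = 0"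
begin

text \<open>The outer function whose squared modulus is \<open>exp (smooth N u)\<close>.\<close>

definition outer_approx :: "nat \<Rightarrow> (nat \<Rightarrow> complex) \<Rightarrow> complex" where
  "outer_approx N x = exp (half_trig N u x)"

lemma measurable_outer_approx [measurable]: "outer_approx N \<in> borel_measurable torus_haar"
  unfolding outer_approx_def[abs_def] by measurable

text \<open>This is where the hypothesis on the spectrum enters: it makes the part of nonnegative degree of
  \<open>smooth N u\<close> analytic and its part of degree 0 constant.\<close>

lemma smooth_coeff_nonneg_degree:
  assumes "smooth_coeff N u n \<noteq> 0" "0 \<le> d n"
  shows "n \<in> Z_plus" and "d n = 0 \<Longrightarrow> n = 0"
proof -
  have "n \<in> Z_plus \<union> uminus ` Z_plus"
    using assms(1) supp by (auto simp: smooth_coeff_def)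
  then have "n \<in> Z_plus \<or> - n \<in> Z_plus" by auto
  moreover have "n = 0" if "- n \<in> Z_plus"
    using d_pos[OF that] assms(2) by fastforce
  ultimately show n: "n \<in> Z_plus" by (auto simp: Z_plus_def)
  show "n = 0" if "d n = 0" using d_pos[OF n] that by fastforce
qed

lemma level_part_const:
  assumes x: "x \<in> space torus_haar"
  shows "level_part N u x = (\<integral>x. u x \<partial>torus_haar)"
proof -
  have "complex_of_real (level_part N u x) = (\<Sum>n\<in>{n \<in> freqs N. d n = 0}.
      if n = 0 then complex_of_real (\<integral>x. u x \<partial>torus_haar) else 0)"
    unfolding level_part_eq[OF x] trig_def
  proof (intro sum.cong refl)
    fix n assume "n \<in> {n \<in> freqs N. d n = 0}"
    then show "smooth_coeff N u n * character n x =
        (if n = 0 then complex_of_real (\<integral>x. u x \<partial>torus_haar) else 0)"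
      using smooth_coeff_nonneg_degree(2)[of N n]
      by (cases "n = 0") (auto simp: smooth_coeff_def fourier_0)
  qed
  also have "\<dots> = complex_of_real (\<integral>x. u x \<partial>torus_haar)"
    by (subst sum.delta) (auto simp: zero_in_freqs)
  finally show ?thesis by (simp only: of_real_eq_iff)
qed

lemma spectrum_outer_approx: "spectrum_in Z_plus (outer_approx N)"
proof -
  let ?c = "\<lambda>n. (if d n = 0 then 1 / 2 else 1) * smooth_coeff N u n"
  have "spectrum_in Z_plus (\<lambda>x. 1 * exp (trig {n \<in> freqs N. 0 \<le> d n} ?c x))"
  proof (rule spectrum_in_mult_exp[where T = Z_plus])
    show "spectrum_in Z_plus (\<lambda>_. 1)" by (rule spectrum_in_const) (simp add: Z_plus_def)
    show "m \<in> Z_plus" if "m \<in> {n \<in> freqs N. 0 \<le> d n}" "?c m \<noteq> 0" for m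
      using smooth_coeff_nonneg_degree(1)[of N m] that by auto
    show "s + t \<in> Z_plus" if "s \<in> Z_plus" "t \<in> Z_plus" for s t
      using that by (simp add: Z_plus_def lookup_add)
  qed simp
  then show ?thesis
    by (rule spectrum_in_cong) (simp add: outer_approx_def half_trig_eq_trig)
qed

text \<open>In \<open>integral_mult_exp_half_trig\<close> with \<open>f = outer_approx N\<close> the integrand is 1.\<close>

lemma fourier_0_outer_approx:
  "fourier (outer_approx N) 0 = complex_of_real (exp ((\<integral>x. u x \<partial>torus_haar) / 2))"
proof -
  let ?m = "\<integral>x. u x \<partial>torus_haar"
  have "(\<integral>x. outer_approx N x * exp (- half_trig N u x) \<partial>torus_haar) = 1"
    by (simp add: outer_approx_def torus.prob_space flip: exp_add)
  moreover have "(\<integral>x. exp (- level_part N u x / 2) \<partial>torus_haar) = (\<integral>x. exp (- ?m / 2) \<partial>torus_haar)"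
    by (intro Bochner_Integration.integral_cong refl) (simp add: level_part_const)
  ultimately have "1 = fourier (outer_approx N) 0 * complex_of_real (exp (- ?m / 2))"
    using integral_mult_exp_half_trig(1)[OF spectrum_outer_approx[of N], of N u]
    by (simp add: torus.prob_space)
  then have "complex_of_real (exp (?m / 2)) =
      fourier (outer_approx N) 0 * (complex_of_real (exp (- ?m / 2)) * complex_of_real (exp (?m / 2)))"
    by (simp add: mult.assoc[symmetric])
  also have "complex_of_real (exp (- ?m / 2)) * complex_of_real (exp (?m / 2)) = 1"
    by (simp flip: of_real_mult exp_add)
  finally show ?thesis by simp
qed

lemma norm_outer_approx:
  assumes "x \<in> space torus_haar"
  shows "(cmod (outer_approx N x))\<^sup>2 = exp (smooth N u x)"
  by (simp add: outer_approx_def Re_half_trig[OF u assms] power2_eq_square flip: exp_add)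

lemma norm_outer_approx_le:
  assumes "x \<in> space torus_haar"
  shows "(cmod (outer_approx N x))\<^sup>2 \<le> smooth N (\<lambda>x. exp (u x)) x"
  unfolding norm_outer_approx[OF assms] by (rule exp_smooth_le[OF u eu assms])

lemma integrable_outer_approx_sq: "integrable torus_haar (\<lambda>x. (cmod (outer_approx N x))\<^sup>2)"
  by (rule Bochner_Integration.integrable_bound[OF integrable_smooth[OF eu, of N]])
     (auto intro!: AE_I2 order.trans[OF norm_outer_approx_le abs_ge_self])

text \<open>Integration of \<open>norm_diff_le_ln_defect\<close>, with Jensen's inequality for the midpoint, whose mean is
  that of the \<open>outer_approx\<close> themselves.\<close>

lemma L1_dist_outer_approx_le:
  assumes \<epsilon>: "0 < \<epsilon>" "\<epsilon> \<le> 1" and \<tau>: "0 < \<tau>"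
  defines "W \<equiv> \<lambda>x. exp (u x)"
  shows "(\<integral>x. cmod (outer_approx j x - outer_approx k x) \<partial>torus_haar) \<le>
    \<tau> / 2 * ((\<integral>x. W x \<partial>torus_haar) + 1) +
    ((\<integral>x. \<bar>smooth j W x - W x\<bar> \<partial>torus_haar) + (\<integral>x. \<bar>smooth k W x - W x\<bar> \<partial>torus_haar)) / (\<tau> * \<epsilon>) +
    2 / \<tau> * ((\<integral>x. ln (W x + \<epsilon>) \<partial>torus_haar) - (\<integral>x. u x \<partial>torus_haar))"
proof -
  let ?g = "outer_approx" and ?f = "\<lambda>x. (outer_approx j x + outer_approx k x) / 2"
  let ?A = "\<lambda>N x. \<bar>smooth N W x - W x\<bar>"
  have gi: "integrable torus_haar (?g N)" for N
    using spectrum_outer_approx by (simp add: spectrum_in_def)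
  have W: "integrable torus_haar W" using eu by (simp add: W_def)
  have Ai: "integrable torus_haar (?A N)" for N
    using W integrable_smooth[OF W] by simp
  have f: "spectrum_in Z_plus ?f"
  proof -
    have sum: "spectrum_in Z_plus (\<lambda>x. ?g j x + ?g k x)"
      by (intro spectrum_in_add spectrum_outer_approx)
    have half: "fourier ?f n = fourier (\<lambda>x. ?g j x + ?g k x) n / 2" for n
      using fourier_cmult[of "1 / 2" "\<lambda>x. ?g j x + ?g k x" n] by simp
    show ?thesis
      unfolding spectrum_in_def half using sum by (auto simp: spectrum_in_def)
  qed
  have f0: "fourier ?f 0 = complex_of_real (exp ((\<integral>x. u x \<partial>torus_haar) / 2))"
    using fourier_cmult[of "1 / 2" "\<lambda>x. ?g j x + ?g k x" 0] gi
    by (simp add: fourier_add fourier_0_outer_approx)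
  have par: "(cmod ((a + b) / 2))\<^sup>2 \<le> (cmod a)\<^sup>2 + (cmod b)\<^sup>2" for a b :: complex
  proof -
    have "(cmod ((a + b) / 2))\<^sup>2 + (cmod ((a - b) / 2))\<^sup>2 = ((cmod a)\<^sup>2 + (cmod b)\<^sup>2) / 2"
      unfolding norm_divide power_divide cmod_power2
      by (simp add: power2_eq_square algebra_simps) (simp add: field_simps)
    then show ?thesis
      using zero_le_power2[of "cmod ((a - b) / 2)"] zero_le_power2[of "cmod a"] zero_le_power2[of "cmod b"]
      by argo
  qed
  have fsq: "integrable torus_haar (\<lambda>x. (cmod (?f x))\<^sup>2)"
    by (rule Bochner_Integration.integrable_bound[OF Bochner_Integration.integrable_add[OF
            integrable_outer_approx_sq[of j] integrable_outer_approx_sq[of k]]])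
       (use par in \<open>auto intro!: AE_I2\<close>)
  have jensen: "(\<integral>x. u x \<partial>torus_haar) \<le> (\<integral>x. ln ((cmod (?f x))\<^sup>2 + \<epsilon>) \<partial>torus_haar)"
    using jensen_regularized[OF f fsq \<epsilon>(1)] unfolding f0 norm_of_real by simp
  have lnW: "integrable torus_haar (\<lambda>x. ln (W x + \<epsilon>))"
    using \<epsilon> by (intro integrable_ln_add W) (auto simp: W_def)
  have lnf: "integrable torus_haar (\<lambda>x. ln ((cmod (?f x))\<^sup>2 + \<epsilon>))"
    using \<epsilon> by (intro integrable_ln_add fsq) auto
  have "(\<integral>x. cmod (?g j x - ?g k x) \<partial>torus_haar) \<le> (\<integral>x. \<tau> / 2 * (W x + 1) +
      (?A j x + ?A k x) / (\<tau> * \<epsilon>) + 2 / \<tau> * (ln (W x + \<epsilon>) - ln ((cmod (?f x))\<^sup>2 + \<epsilon>)) \<partial>torus_haar)"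
  proof (rule integral_mono)
    fix x assume x: "x \<in> space torus_haar"
    have "(cmod (?g N x))\<^sup>2 \<le> W x + ?A N x" for N
      using norm_outer_approx_le[OF x, of N] by (simp add: W_def)
    then show "cmod (?g j x - ?g k x) \<le> \<tau> / 2 * (W x + 1) +
      (?A j x + ?A k x) / (\<tau> * \<epsilon>) + 2 / \<tau> * (ln (W x + \<epsilon>) - ln ((cmod (?f x))\<^sup>2 + \<epsilon>))"
      by (intro norm_diff_le_ln_defect \<epsilon> \<tau>) (auto simp: W_def)
  next
    show "integrable torus_haar (\<lambda>x. \<tau> / 2 * (W x + 1) +
      (?A j x + ?A k x) / (\<tau> * \<epsilon>) + 2 / \<tau> * (ln (W x + \<epsilon>) - ln ((cmod (?f x))\<^sup>2 + \<epsilon>)))"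
      by (intro Bochner_Integration.integrable_add Bochner_Integration.integrable_diff
          integrable_mult_right integrable_divide Ai W lnW lnf torus.integrable_const)
  qed (intro integrable_norm Bochner_Integration.integrable_diff gi)
  also have "\<dots> = \<tau> / 2 * ((\<integral>x. W x \<partial>torus_haar) + 1) +
      ((\<integral>x. ?A j x \<partial>torus_haar) + (\<integral>x. ?A k x \<partial>torus_haar)) / (\<tau> * \<epsilon>) +
      2 / \<tau> * ((\<integral>x. ln (W x + \<epsilon>) \<partial>torus_haar) - (\<integral>x. ln ((cmod (?f x))\<^sup>2 + \<epsilon>) \<partial>torus_haar))"
    by (simp only: Bochner_Integration.integral_add Bochner_Integration.integral_diff
        integral_mult_right_zero integral_divide_zero
        Bochner_Integration.integrable_add Bochner_Integration.integrable_diff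
        integrable_mult_right integrable_divide Ai W lnW lnf torus.integrable_const)
      (simp add: torus.prob_space)
  also have "\<dots> \<le> \<tau> / 2 * ((\<integral>x. W x \<partial>torus_haar) + 1) +
      ((\<integral>x. ?A j x \<partial>torus_haar) + (\<integral>x. ?A k x \<partial>torus_haar)) / (\<tau> * \<epsilon>) +
      2 / \<tau> * ((\<integral>x. ln (W x + \<epsilon>) \<partial>torus_haar) - (\<integral>x. u x \<partial>torus_haar))"
    using jensen \<tau> by (intro add_left_mono mult_left_mono) auto
  finally show ?thesis .
qed

text \<open>The three terms of \<open>L1_dist_outer_approx_le\<close> are made small in turn: the first by \<open>\<tau>\<close>, the third
  by \<open>\<epsilon>\<close>, which depends on \<open>\<tau>\<close>, and the second by large indices.\<close>

lemma Cauchy_outer_approx: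
  assumes e: "0 < e"
  shows "\<exists>K. \<forall>j\<ge>K. \<forall>k\<ge>K. (\<integral>x. cmod (outer_approx j x - outer_approx k x) \<partial>torus_haar) < e"
proof -
  define W where "W = (\<lambda>x. exp (u x))"
  define C where "C = (\<integral>x. W x \<partial>torus_haar)"
  define m where "m = (\<integral>x. u x \<partial>torus_haar)"
  define \<tau> where "\<tau> = e / (3 * (C + 1))"
  have W: "integrable torus_haar W" using eu by (simp add: W_def)
  have W_eq: "exp (u x) = W x" for x by (simp add: W_def)
  have C: "0 \<le> C" unfolding C_def W_def by (rule Bochner_Integration.integral_nonneg) simp
  have \<tau>: "0 < \<tau>" "\<tau> / 2 * (C + 1) < e / 3" using e C by (auto simp: \<tau>_def divide_simps)
  have "(\<lambda>i. \<integral>x. ln (W x + inverse (real (Suc i))) \<partial>torus_haar) \<longlonglongrightarrow> (\<integral>x. ln (W x) \<partial>torus_haar)"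
    by (rule ln_regularized_limits(1)) (use W u in \<open>auto simp: W_def\<close>)
  then have "(\<lambda>i. \<integral>x. ln (W x + inverse (real (Suc i))) \<partial>torus_haar) \<longlonglongrightarrow> m"
    by (simp add: W_def m_def)
  then have "eventually (\<lambda>i. (\<integral>x. ln (W x + inverse (real (Suc i))) \<partial>torus_haar) < m + e * \<tau> / 6) sequentially"
    by (rule order_tendstoD) (use e \<tau> in auto)
  then obtain i where i: "(\<integral>x. ln (W x + inverse (real (Suc i))) \<partial>torus_haar) < m + e * \<tau> / 6"
    by (auto simp: eventually_sequentially)
  define \<epsilon> where "\<epsilon> = inverse (real (Suc i))"
  have \<epsilon>: "0 < \<epsilon>" "\<epsilon> \<le> 1" by (simp_all add: \<epsilon>_def field_simps)
  have "0 < e * (\<tau> * \<epsilon>) / 6" using e \<tau> \<epsilon> by simp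
  from order_tendstoD(2)[OF smooth_tendsto[OF W] this] obtain K where
    K: "\<And>N. N \<ge> K \<Longrightarrow> (\<integral>x. \<bar>smooth N W x - W x\<bar> \<partial>torus_haar) < e * (\<tau> * \<epsilon>) / 6"
    by (auto simp: eventually_sequentially)
  show ?thesis
  proof (intro exI allI impI)
    fix j k assume jk: "K \<le> j" "K \<le> k"
    have "((\<integral>x. \<bar>smooth j W x - W x\<bar> \<partial>torus_haar) + (\<integral>x. \<bar>smooth k W x - W x\<bar> \<partial>torus_haar)) / (\<tau> * \<epsilon>) < e / 3"
      using K[OF jk(1)] K[OF jk(2)] \<tau>(1) \<epsilon>(1) by (simp add: pos_divide_less_eq)
    moreover have "2 / \<tau> * ((\<integral>x. ln (W x + \<epsilon>) \<partial>torus_haar) - m) < e / 3"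
    proof -
      have "2 / \<tau> * ((\<integral>x. ln (W x + \<epsilon>) \<partial>torus_haar) - m) < 2 / \<tau> * (e * \<tau> / 6)"
        using i \<tau>(1) by (intro mult_strict_left_mono) (auto simp: \<epsilon>_def)
      also have "\<dots> = e / 3" using \<tau>(1) by simp
      finally show ?thesis .
    qed
    ultimately show "(\<integral>x. cmod (outer_approx j x - outer_approx k x) \<partial>torus_haar) < e"
      using L1_dist_outer_approx_le[OF \<epsilon> \<tau>(1), of j k, folded W_def, unfolded W_eq, folded C_def m_def] \<tau>(2) by linarith
  qed
qed

text \<open>Two subsequences are taken: along the first the Fejer means of \<open>u\<close> converge almost everywhere,
  which determines the modulus of the limit; along the second the functions themselves converge
  almost everywhere.\<close>

lemma exists_outer_function:
  obtains g where "g \<in> borel_measurable torus_haar" "AE x in torus_haar. (cmod (g x))\<^sup>2 = exp (u x)"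
    "spectrum_in Z_plus g" "fourier g 0 = complex_of_real (exp ((\<integral>x. u x \<partial>torus_haar) / 2))"
proof -
  obtain r0 where r0: "strict_mono r0" "AE x in torus_haar. (\<lambda>i. smooth (r0 i) u x) \<longlonglongrightarrow> u x"
    using smooth_AE_subsequence[OF u] by blast
  have "\<exists>K. \<forall>j\<ge>K. \<forall>k\<ge>K. (\<integral>x. cmod (outer_approx (r0 j) x - outer_approx (r0 k) x) \<partial>torus_haar) < e"
    if e: "0 < e" for e
  proof -
    obtain K where "\<forall>j\<ge>K. \<forall>k\<ge>K. (\<integral>x. cmod (outer_approx j x - outer_approx k x) \<partial>torus_haar) < e"
      using Cauchy_outer_approx[OF e] by blast
    then show ?thesis
      using seq_suble[OF r0(1)] by (intro exI[of _ K]) (meson order.trans)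
  qed
  then obtain r1 where r1: "strict_mono r1" "AE x in torus_haar. Cauchy (\<lambda>i. outer_approx (r0 (r1 i)) x)"
    using cauchy_L1_AE_cauchy_subseq[of torus_haar "\<lambda>i. outer_approx (r0 i)"] spectrum_outer_approx
    unfolding spectrum_in_def by blast
  define s where "s i = outer_approx (r0 (r1 i))" for i
  define g where "g x = lim (\<lambda>i. s i x)" for x
  have s_meas [measurable]: "s i \<in> borel_measurable torus_haar" for i by (simp add: s_def)
  have g_meas [measurable]: "g \<in> borel_measurable torus_haar"
    unfolding g_def by measurable
  have lim: "AE x in torus_haar. (\<lambda>i. s i x) \<longlonglongrightarrow> g x"
    using r1(2)
  proof eventually_elim
    case (elim x)
    then show ?case unfolding s_def[symmetric] g_def by (metis Cauchy_convergent convergent_LIMSEQ_iff)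
  qed
  have g_sq: "AE x in torus_haar. (cmod (g x))\<^sup>2 = exp (u x)"
    using lim r0(2) AE_space
  proof eventually_elim
    case (elim x)
    have "(\<lambda>i. exp (smooth (r0 (r1 i)) u x)) \<longlonglongrightarrow> exp (u x)"
      using LIMSEQ_subseq_LIMSEQ[OF elim(2) r1(1), unfolded comp_def] by (rule tendsto_exp)
    moreover have "(\<lambda>i. (cmod (s i x))\<^sup>2) \<longlonglongrightarrow> (cmod (g x))\<^sup>2"
      using elim(1) by (intro tendsto_power tendsto_norm)
    ultimately show ?case
      unfolding s_def norm_outer_approx[OF elim(3)] by (rule LIMSEQ_unique[rotated])
  qed
  have gsq_int: "integrable torus_haar (\<lambda>x. (cmod (g x))\<^sup>2)"
    using integrable_cong_AE[THEN iffD2, OF _ _ g_sq] eu by simp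
  have gi: "integrable torus_haar g"
    by (rule integrable_of_square_integrable[OF g_meas gsq_int])
  have si: "integrable torus_haar (s i)" for i
    using spectrum_outer_approx by (simp add: s_def spectrum_in_def)
  let ?C = "\<integral>x. exp (u x) \<partial>torus_haar"
  have s_sq: "(\<integral>x. (cmod (s i x))\<^sup>2 \<partial>torus_haar) \<le> ?C" for i
  proof -
    have "(\<integral>x. (cmod (s i x))\<^sup>2 \<partial>torus_haar) \<le> (\<integral>x. smooth (r0 (r1 i)) (\<lambda>x. exp (u x)) x \<partial>torus_haar)"
      unfolding s_def
      by (intro integral_mono integrable_outer_approx_sq integrable_smooth eu norm_outer_approx_le)
    then show ?thesis by (simp add: integral_smooth[OF eu])
  qed
  have g_sq_int: "(\<integral>x. (cmod (g x))\<^sup>2 \<partial>torus_haar) = ?C"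
    by (rule integral_cong_AE) (use g_sq eu in auto)
  have par: "(cmod (a - b))\<^sup>2 \<le> 2 * (cmod a)\<^sup>2 + 2 * (cmod b)\<^sup>2" for a b :: complex
  proof -
    have "(cmod (a - b))\<^sup>2 + (cmod (a + b))\<^sup>2 = 2 * (cmod a)\<^sup>2 + 2 * (cmod b)\<^sup>2"
      unfolding cmod_power2 by (simp add: power2_eq_square algebra_simps)
    then show ?thesis using zero_le_power2[of "cmod (a + b)"] by linarith
  qed
  have sq_int: "integrable torus_haar (\<lambda>x. 2 * (cmod (s i x))\<^sup>2 + 2 * (cmod (g x))\<^sup>2)" for i
    using integrable_outer_approx_sq gsq_int by (simp add: s_def)
  have diff_int: "integrable torus_haar (\<lambda>x. (cmod (s i x - g x))\<^sup>2)" for i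
    by (rule Bochner_Integration.integrable_bound[OF sq_int[of i]])
       (auto intro!: AE_I2 par)
  \<comment> \<open>Convergence almost everywhere with bounded \<open>L\<^sup>2\<close> norms is enough for the Fourier coefficients
    to converge.\<close>
  have L1: "(\<lambda>i. \<integral>x. cmod (s i x - g x) \<partial>torus_haar) \<longlonglongrightarrow> 0"
  proof (rule L1_tendsto_0_of_L2_bounded[where C = "4 * ?C"])
    fix i
    have "(\<integral>x. (cmod (s i x - g x))\<^sup>2 \<partial>torus_haar) \<le>
        (\<integral>x. 2 * (cmod (s i x))\<^sup>2 + 2 * (cmod (g x))\<^sup>2 \<partial>torus_haar)"
      by (intro integral_mono diff_int sq_int par)
    also have "\<dots> = 2 * (\<integral>x. (cmod (s i x))\<^sup>2 \<partial>torus_haar) + 2 * (\<integral>x. (cmod (g x))\<^sup>2 \<partial>torus_haar)"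
      using integrable_outer_approx_sq gsq_int by (simp add: s_def)
    also have "\<dots> \<le> 4 * ?C" using s_sq[of i] g_sq_int by simp
    finally show "(\<integral>x. (cmod (s i x - g x))\<^sup>2 \<partial>torus_haar) \<le> 4 * ?C" .
    show "AE x in torus_haar. (\<lambda>i. s i x - g x) \<longlonglongrightarrow> 0"
      using lim by eventually_elim (simp add: LIM_zero)
  qed (use diff_int in auto)
  have F: "(\<lambda>i. fourier (s i) n) \<longlonglongrightarrow> fourier g n" for n
  proof (rule LIM_zero_cancel, rule tendsto_norm_zero_cancel)
    show "(\<lambda>i. norm (fourier (s i) n - fourier g n)) \<longlonglongrightarrow> 0"
    proof (rule tendsto_sandwich[OF _ _ tendsto_const L1])
      show "eventually (\<lambda>i. norm (fourier (s i) n - fourier g n) \<le> (\<integral>x. cmod (s i x - g x) \<partial>torus_haar)) sequentially"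
        using norm_fourier_le[of "\<lambda>x. s _ x - g x" n] by (simp add: fourier_diff[OF si gi])
    qed simp
  qed
  have "spectrum_in Z_plus g"
    unfolding spectrum_in_def
  proof (intro conjI gi allI impI)
    fix n assume "n \<notin> Z_plus"
    then have "fourier (s i) n = 0" for i
      using spectrum_outer_approx by (simp add: s_def spectrum_in_def)
    then show "fourier g n = 0" using F[of n] by (simp add: LIMSEQ_const_iff)
  qed
  moreover have "fourier g 0 = complex_of_real (exp ((\<integral>x. u x \<partial>torus_haar) / 2))"
    using F[of 0] by (simp add: s_def fourier_0_outer_approx LIMSEQ_const_iff)
  ultimately show ?thesis using that g_meas g_sq by blast
qed

end

end

text \<open>The extended integral agrees with the Bochner integral where both make sense.\<close>

lemma ext_integral_eq:
  assumes v: "integrable M v" and eq: "AE x in M. U x = ereal (v x)"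
  shows "ext_integral M U = ereal (\<integral>x. v x \<partial>M)"
proof -
  have "(\<integral>\<^sup>+x. e2ennreal (U x) \<partial>M) = (\<integral>\<^sup>+x. ennreal (v x) \<partial>M)"
    using eq by (intro nn_integral_cong_AE) (auto elim!: eventually_mono)
  moreover have "(\<integral>\<^sup>+x. e2ennreal (- U x) \<partial>M) = (\<integral>\<^sup>+x. ennreal (- v x) \<partial>M)"
    using eq by (intro nn_integral_cong_AE) (auto elim!: eventually_mono)
  moreover obtain a b where "0 \<le> a" "0 \<le> b" "(\<integral>\<^sup>+x. ennreal (v x) \<partial>M) = ennreal a"
    "(\<integral>\<^sup>+x. ennreal (- v x) \<partial>M) = ennreal b" "(\<integral>x. v x \<partial>M) = a - b"
    using real_integrable_def[of M v] v real_lebesgue_integral_def[OF v]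
    by (metis enn2real_nonneg ennreal_enn2real_if infinity_ennreal_def)
  ultimately show ?thesis by (simp add: ext_integral_def enn2ereal_ennreal)
qed

text \<open>At points where \<open>w\<close> is not positive the integrand is infinite, so they form a null set.\<close>

lemma ext_integrable_log_ext:
  assumes w [measurable]: "w \<in> borel_measurable M" and ext: "ext_integrable M (\<lambda>x. log_ext (w x))"
  shows "AE x in M. 0 < w x" and "integrable M (\<lambda>x. ln (w x))"
proof -
  have [measurable]: "(\<lambda>x. log_ext (w x)) \<in> borel_measurable M"
    and fin: "(\<integral>\<^sup>+x. e2ennreal \<bar>log_ext (w x)\<bar> \<partial>M) < \<infinity>"
    using ext by (auto simp: ext_integrable_def)
  have "AE x in M. e2ennreal \<bar>log_ext (w x)\<bar> \<noteq> \<infinity>"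
    using fin by (intro nn_integral_noteq_infinite) auto
  then show pos: "AE x in M. 0 < w x"
    by eventually_elim (auto simp: log_ext_def split: if_splits)
  have "(\<integral>\<^sup>+x. ennreal (norm (ln (w x))) \<partial>M) = (\<integral>\<^sup>+x. e2ennreal \<bar>log_ext (w x)\<bar> \<partial>M)"
    using pos by (intro nn_integral_cong_AE) (auto elim!: eventually_mono simp: log_ext_def)
  with fin show "integrable M (\<lambda>x. ln (w x))"
    by (intro integrableI_bounded) auto
qed

theorem theorem6p1:
  fixes w :: "(nat \<Rightarrow> complex) \<Rightarrow> real"
  assumes "integrable torus_haar w"
    and "AE x in torus_haar. 0 \<le> w x"
    and "ext_integrable torus_haar (\<lambda>x. log_ext (w x))"
  shows "(\<exists>g\<in>H2_plus. outer g \<and> (AE x in torus_haar. w x = (cmod (g x))\<^sup>2)) \<longleftrightarrow>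
    (\<forall>n. n \<notin> Z_plus \<union> uminus ` Z_plus \<longrightarrow>
      fourier (\<lambda>x. complex_of_real (ln (w x))) n = 0)"
proof -
  have [measurable]: "w \<in> borel_measurable torus_haar" using assms(1) by simp
  note pos = ext_integrable_log_ext(1)[OF _ assms(3), simplified]
    and lnw = ext_integrable_log_ext(2)[OF _ assms(3), simplified]
  let ?m = "\<integral>x. ln (w x) \<partial>torus_haar"
  have log_g: "ext_integral torus_haar (\<lambda>x. log_ext (cmod (g x))) = ereal (?m / 2)"
    if "AE x in torus_haar. w x = (cmod (g x))\<^sup>2" for g
  proof -
    have "AE x in torus_haar. log_ext (cmod (g x)) = ereal (ln (w x) / 2)"
      using that pos
    proof eventually_elim
      case (elim x)
      then have "0 < cmod (g x)" by auto
      then show ?case using elim(1) by (simp add: log_ext_def ln_realpow)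
    qed
    then have "ext_integral torus_haar (\<lambda>x. log_ext (cmod (g x))) = ereal (\<integral>x. ln (w x) / 2 \<partial>torus_haar)"
      using lnw by (intro ext_integral_eq) auto
    then show ?thesis by simp
  qed
  show ?thesis
  proof
    assume "\<exists>g\<in>H2_plus. outer g \<and> (AE x in torus_haar. w x = (cmod (g x))\<^sup>2)"
    then obtain g where g: "g \<in> H2_plus" "outer g" and wg: "AE x in torus_haar. w x = (cmod (g x))\<^sup>2"
      by blast
    have [measurable]: "g \<in> borel_measurable torus_haar"
      and sq: "integrable torus_haar (\<lambda>x. (cmod (g x))\<^sup>2)"
      using g(1) by (auto simp: H2_plus_def)
    have spec: "spectrum_in Z_plus g"
      unfolding spectrum_in_def
    proof
      show "integrable torus_haar g" by (rule integrable_of_square_integrable[OF _ sq]) simp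
      show "\<forall>n. n \<notin> Z_plus \<longrightarrow> fourier g n = 0" using g(1) by (simp add: H2_plus_def)
    qed
    have "exp (?m / 2) = cmod (fourier g 0)"
      using g(2) unfolding outer_def log_g[OF wg] by (simp add: exp_ext_def fourier_0)
    then have "ln (cmod (fourier g 0)) = ?m / 2" "cmod (fourier g 0) \<noteq> 0"
      by (metis ln_exp, metis exp_not_eq_zero)
    then have g0: "?m = 2 * ln (cmod (fourier g 0))" "fourier g 0 \<noteq> 0" by auto
    have eq: "AE x in torus_haar. ln ((cmod (g x))\<^sup>2) = ln (w x)"
      using wg by eventually_elim simp
    have ln_int: "integrable torus_haar (\<lambda>x. ln ((cmod (g x))\<^sup>2))"
      using integrable_cong_AE[THEN iffD2, OF _ _ eq] lnw by simp
    have ln_eq: "(\<integral>x. ln ((cmod (g x))\<^sup>2) \<partial>torus_haar) = ?m"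
      by (rule integral_cong_AE) (use eq in auto)
    have pos_g: "AE x in torus_haar. 0 < (cmod (g x))\<^sup>2"
      using wg pos by eventually_elim simp
    show "\<forall>n. n \<notin> Z_plus \<union> uminus ` Z_plus \<longrightarrow> fourier (\<lambda>x. complex_of_real (ln (w x))) n = 0"
    proof (intro allI impI)
      fix n assume n: "n \<notin> Z_plus \<union> uminus ` Z_plus"
      then obtain d where d: "positive_grading d" "d n = 0"
        by (rule exists_positive_grading_eq_0)
      have "n \<noteq> 0" using n by (auto simp: Z_plus_def)
      have "fourier (\<lambda>x. complex_of_real (ln (w x))) n = fourier (\<lambda>x. complex_of_real (ln ((cmod (g x))\<^sup>2))) n"
        using eq by (intro fourier_cong_AE) (auto elim!: eventually_mono)
      also have "\<dots> = 0"
        using positive_grading.fourier_log_eq_0[OF d(1) spec sq pos_g ln_int _ g0(2) d(2) \<open>n \<noteq> 0\<close>] ln_eq g0(1)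
        by simp
      finally show "fourier (\<lambda>x. complex_of_real (ln (w x))) n = 0" .
    qed
  next
    assume supp: "\<forall>n. n \<notin> Z_plus \<union> uminus ` Z_plus \<longrightarrow> fourier (\<lambda>x. complex_of_real (ln (w x))) n = 0"
    have ew: "AE x in torus_haar. exp (ln (w x)) = w x"
      using pos by eventually_elim simp
    have ew_int: "integrable torus_haar (\<lambda>x. exp (ln (w x)))"
      using integrable_cong_AE[THEN iffD2, OF _ _ ew] assms(1) by simp
    \<comment> \<open>Any grading will do; this is the total degree.\<close>
    interpret total: positive_grading "\<lambda>n. \<Sum>k\<in>keys n. 1 * lookup n k"
      by (rule positive_grading_weighted_degree) simp
    obtain g where g: "g \<in> borel_measurable torus_haar"
      "AE x in torus_haar. (cmod (g x))\<^sup>2 = exp (ln (w x))"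
      "spectrum_in Z_plus g" "fourier g 0 = complex_of_real (exp (?m / 2))"
      using total.exists_outer_function[OF lnw ew_int] supp by blast
    have wg: "AE x in torus_haar. w x = (cmod (g x))\<^sup>2"
      using g(2) ew by eventually_elim simp
    have [measurable]: "g \<in> borel_measurable torus_haar" by (rule g(1))
    have "integrable torus_haar (\<lambda>x. (cmod (g x))\<^sup>2)"
      using integrable_cong_AE[THEN iffD1, OF _ _ wg] assms(1) by simp
    then have H2: "g \<in> H2_plus"
      using g(1,3) by (simp add: H2_plus_def spectrum_in_def)
    moreover have "outer g"
      unfolding outer_def log_g[OF wg] using H2 g(4) by (simp add: exp_ext_def fourier_0)
    ultimately show "\<exists>g\<in>H2_plus. outer g \<and> (AE x in torus_haar. w x = (cmod (g x))\<^sup>2)"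
      using wg by blast
  qed
qed

end
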